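(* Let $A\in\operatorname{span}\mathfrak{C}$ and $U\in\operatorname{Inv}\mathfrak{C}$. Then $\|U*A\|_*=\|A\|_*=\|A*U\|_*$. Therefore, for all $U,V\in\operatorname{Inv}\mathfrak{C}$, the shuffling map $S_{U,V}(A)=U*A*V$ on $\operatorname{span}\mathfrak{C}$ is an isometry with respect to the $*$-norm.
   Context: $\mathfrak{C}$ is the set of copulas, i.e. functions $C\colon[0,1]^2\to[0,1]$ with $C(u,0)=0=C(0,v)$, $C(u,1)=u$, $C(1,v)=v$ and $C(u,v)-C(u,y)-C(x,v)+C(x,y)\ge 0$ whenever $x\le u$, $y\le v$; $\operatorname{span}\mathfrak{C}$ is its linear span. On $\operatorname{span}\mathfrak{C}$, the $*$-product is $(A*B)(x,y)=\int_0^1\partial_2A(x,t)\,\partial_1B(t,y)\,dt$ and the Sobolev norm is $\|A\|^2=\int_0^1\int_0^1\big((\partial_1A)^2+(\partial_2A)^2\big)\,dx\,dy$. With $M(x,y)=\min(x,y)$, $\operatorname{Inv}\mathfrak{C}$ is the set of invertible copulas, i.e. copulas $U$ for which there is a copula $D$ with $U*D=M=D*U$; equivalently (known), copulas with $\|U\|=1$. The $*$-norm is $\|A\|_*=\sup_{U,V\in\operatorname{Inv}\mathfrak{C}}\|U*A*V\|$ for $A\in\operatorname{span}\mathfrak{C}$. *)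

theory Defs
  imports "HOL-Analysis.Analysis" "HOL-Library.Function_Algebras"
begin

text \<open>
  A function on the unit square is represented by its extension by zero to the plane: this
  makes equality of functions on the square plain equality, and it is compatible with the
  pointwise vector space operations (the operations + and - on functions below are those of
  Function Algebras).
\<close>

definition copula :: "(real \<Rightarrow> real \<Rightarrow> real) \<Rightarrow> bool" where
  "copula C \<longleftrightarrow>
     (\<forall>x y. \<not> (x \<in> {0..1} \<and> y \<in> {0..1}) \<longrightarrow> C x y = 0) \<and>
     (\<forall>x\<in>{0..1}. \<forall>y\<in>{0..1}. C x y \<in> {0..1}) \<and>
     (\<forall>u\<in>{0..1}. C u 0 = 0 \<and> C u 1 = u) \<and>
     (\<forall>v\<in>{0..1}. C 0 v = 0 \<and> C 1 v = v) \<and>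
     (\<forall>x\<in>{0..1}. \<forall>u\<in>{0..1}. \<forall>y\<in>{0..1}. \<forall>v\<in>{0..1}.
        x \<le> u \<longrightarrow> y \<le> v \<longrightarrow> C u v - C u y - C x v + C x y \<ge> 0)"

definition fun_scale :: "real \<Rightarrow> (real \<Rightarrow> real \<Rightarrow> real) \<Rightarrow> real \<Rightarrow> real \<Rightarrow> real" where
  "fun_scale c A = (\<lambda>x y. c * A x y)"

global_interpretation fun_space: vector_space fun_scale
  by unfold_locales (auto simp: fun_scale_def fun_eq_iff algebra_simps)

definition span_copulas :: "(real \<Rightarrow> real \<Rightarrow> real) set" where
  "span_copulas = fun_space.span {C. copula C}"

text \<open>
  Partial derivatives are taken within the unit interval, hence one-sided at its end points.
  For functions in the span of the copulas they exist almost everywhere; elsewhere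
  \<^const>\<open>vector_derivative\<close> has some fixed value, which does not affect the integrals below.
\<close>

definition partial1 :: "(real \<Rightarrow> real \<Rightarrow> real) \<Rightarrow> real \<Rightarrow> real \<Rightarrow> real" where
  "partial1 A x y = vector_derivative (\<lambda>s. A s y) (at x within {0..1})"

definition partial2 :: "(real \<Rightarrow> real \<Rightarrow> real) \<Rightarrow> real \<Rightarrow> real \<Rightarrow> real" where
  "partial2 A x y = vector_derivative (\<lambda>t. A x t) (at y within {0..1})"

definition star_prod ::
  "(real \<Rightarrow> real \<Rightarrow> real) \<Rightarrow> (real \<Rightarrow> real \<Rightarrow> real) \<Rightarrow> real \<Rightarrow> real \<Rightarrow> real"
  (infixl "\<star>" 70) where
  "A \<star> B = (\<lambda>x y. if x \<in> {0..1} \<and> y \<in> {0..1}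
                  then LBINT t:{0..1}. partial2 A x t * partial1 B t y else 0)"

definition sobolev_norm :: "(real \<Rightarrow> real \<Rightarrow> real) \<Rightarrow> real" where
  "sobolev_norm A =
     sqrt (LBINT y:{0..1}. LBINT x:{0..1}. (partial1 A x y)\<^sup>2 + (partial2 A x y)\<^sup>2)"

definition M_copula :: "real \<Rightarrow> real \<Rightarrow> real" where
  "M_copula = (\<lambda>x y. if x \<in> {0..1} \<and> y \<in> {0..1} then min x y else 0)"

definition Inv_copulas :: "(real \<Rightarrow> real \<Rightarrow> real) set" where
  "Inv_copulas =
     {U. copula U \<and> (\<exists>D. copula D \<and> U \<star> D = M_copula \<and> D \<star> U = M_copula)}"

text \<open>
  For \<open>A\<close> in the span of the copulas the supremum is over a nonempty bounded set of reals:
  \<open>U \<star> A \<star> V\<close> is the linear combination, with the coefficients of \<open>A\<close>, of copulas, and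
  copulas have Sobolev norm at most 1.
\<close>

definition star_norm :: "(real \<Rightarrow> real \<Rightarrow> real) \<Rightarrow> real" where
  "star_norm A = (SUP (U, V)\<in>Inv_copulas \<times> Inv_copulas. sobolev_norm (U \<star> A \<star> V))"

definition shuffling ::
  "(real \<Rightarrow> real \<Rightarrow> real) \<Rightarrow> (real \<Rightarrow> real \<Rightarrow> real) \<Rightarrow> (real \<Rightarrow> real \<Rightarrow> real) \<Rightarrow> real \<Rightarrow> real \<Rightarrow> real"
  where "shuffling U V A = U \<star> A \<star> V"

definition star_isometry :: "((real \<Rightarrow> real \<Rightarrow> real) \<Rightarrow> real \<Rightarrow> real \<Rightarrow> real) \<Rightarrow> bool" where
  "star_isometry S \<longleftrightarrow>
     S \<in> span_copulas \<rightarrow> span_copulas \<and>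
     (\<forall>A\<in>span_copulas. \<forall>B\<in>span_copulas. star_norm (S A - S B) = star_norm (A - B))"

end

theory Submission
  imports Defs
begin

text \<open>
  Under the star product the copulas form a monoid with unit \<open>M\<close>, and the product is bilinear and
  associative on their span. The invertible copulas are therefore a group. In
  \<open>\<parallel>U \<star> A\<parallel>\<^sub>* = sup \<parallel>V \<star> (U \<star> A) \<star> W\<parallel>\<close> associativity moves \<open>U\<close> to the index \<open>V\<close>, and since
  \<open>V \<mapsto> V \<star> U\<close> is a bijection of the group (\<open>Inv_translate\<close>), the supremum is that of \<open>A\<close>; the
  factor on the right is treated in the same way. By bilinearity the difference of two shuffled
  functions is the shuffled difference, so shuffling is an isometry.

  The work lies in this algebra, above all in associativity, because the product is defined by
  partial derivatives that exist only almost everywhere. Sections of copulas are Lipschitz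
  continuous, so it suffices to know that a Lipschitz function on the line is differentiable almost
  everywhere and is the integral of its derivative (\<open>Lipschitz_AE_derivative\<close>), and that this
  derivative is Borel measurable (\<open>borel_measurable_vector_derivative\<close>).

  For associativity, write \<open>T\<^sub>B \<phi>\<close> for the derivative of \<open>s \<mapsto> \<integral> \<partial>\<^sub>2B(s, t) \<phi>(t) dt\<close>. With
  \<open>\<psi> = \<partial>\<^sub>2A(x, \<cdot>)\<close> and \<open>\<phi> = \<partial>\<^sub>1C(\<cdot>, y)\<close> the identity \<open>(A \<star> B) \<star> C = A \<star> (B \<star> C)\<close> at \<open>(x, y)\<close> says that
  \<open>\<integral> (T\<^sub>B\<^sub>' \<psi>) \<phi> = \<integral> \<psi> (T\<^sub>B \<phi>)\<close>, where \<open>B'\<close> is the transpose of \<open>B\<close> (\<open>markov_duality\<close>). Since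
  \<open>T\<^sub>B\<close> is a contraction of \<open>L\<^sup>1\<close> (\<open>markov_contraction\<close>), both sides are continuous in \<open>\<phi>\<close> for the
  \<open>L\<^sup>1\<close> norm, and by density of the step functions (\<open>L1_bounded_functional_eq_0\<close>) only the indicator
  functions of the intervals \<open>[0, y]\<close> remain. For these the identity is the fundamental theorem of
  calculus. Transposition exchanges the two variables and the two factors, which halves the rest.
\<close>

section \<open>Lipschitz functions on the real line\<close>

text \<open>
  The Cauchy criterion replaces the unknown derivative by a condition on difference quotients
  alone. If \<open>g\<close> is continuous, then for each fixed pair of increments this condition is closed in
  the point, which is what makes the set of differentiability a Borel set.
\<close>

lemma differentiable_iff_Cauchy_quotients:
  fixes g :: "real \<Rightarrow> real"
  defines "Q \<equiv> \<lambda>t h. (g (t + h) - g t) / h"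
  shows "(\<exists>l. (g has_real_derivative l) (at t)) \<longleftrightarrow>
    (\<forall>m. \<exists>n. \<forall>h k. 0 < \<bar>h\<bar> \<and> \<bar>h\<bar> < 1 / Suc n \<and> 0 < \<bar>k\<bar> \<and> \<bar>k\<bar> < 1 / Suc n
        \<longrightarrow> \<bar>Q t h - Q t k\<bar> \<le> 1 / Suc m)" (is "_ \<longleftrightarrow> ?R")
proof
  assume "\<exists>l. (g has_real_derivative l) (at t)"
  then obtain l where l: "(\<lambda>h. Q t h) \<midarrow>0\<rightarrow> l"
    unfolding DERIV_def Q_def by blast
  show ?R
  proof
    fix m
    have "0 < 1 / (2 * real (Suc m))" by simp
    then obtain d where d: "d > 0" "\<And>h. h \<noteq> 0 \<Longrightarrow> \<bar>h\<bar> < d \<Longrightarrow> \<bar>Q t h - l\<bar> < 1 / (2 * real (Suc m))"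
      using LIM_D[OF l] by (metis diff_zero real_norm_def)
    obtain n where n: "1 / real (Suc n) < d" using d(1)
      by (metis nat_approx_posE)
    show "\<exists>n. \<forall>h k. 0 < \<bar>h\<bar> \<and> \<bar>h\<bar> < 1 / Suc n \<and> 0 < \<bar>k\<bar> \<and> \<bar>k\<bar> < 1 / Suc n
        \<longrightarrow> \<bar>Q t h - Q t k\<bar> \<le> 1 / Suc m"
    proof (intro exI allI impI)
      fix h k :: real
      assume "0 < \<bar>h\<bar> \<and> \<bar>h\<bar> < 1 / Suc n \<and> 0 < \<bar>k\<bar> \<and> \<bar>k\<bar> < 1 / Suc n"
      then have "\<bar>Q t h - l\<bar> < 1 / (2 * real (Suc m))" "\<bar>Q t k - l\<bar> < 1 / (2 * real (Suc m))"
        using d(2)[of h] d(2)[of k] n by auto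
      moreover have "1 / (2 * real (Suc m)) + 1 / (2 * real (Suc m)) = 1 / Suc m"
        by (simp add: field_simps)
      ultimately show "\<bar>Q t h - Q t k\<bar> \<le> 1 / Suc m" by (smt (verit))
    qed
  qed
next
  assume R: ?R
  define s where "s i = Q t (1 / real (Suc i))" for i
  have "Cauchy s"
  proof (rule metric_CauchyI)
    fix e :: real assume "e > 0"
    then obtain m where m: "1 / real (Suc m) < e" by (metis nat_approx_posE)
    obtain n where n: "\<And>h k. 0 < \<bar>h\<bar> \<and> \<bar>h\<bar> < 1 / Suc n \<and> 0 < \<bar>k\<bar> \<and> \<bar>k\<bar> < 1 / Suc n
        \<Longrightarrow> \<bar>Q t h - Q t k\<bar> \<le> 1 / Suc m" using R by blast
    have *: "0 < \<bar>1 / real (Suc i)\<bar> \<and> \<bar>1 / real (Suc i)\<bar> < 1 / Suc n" if "i \<ge> Suc n" for i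
      using that by (simp add: field_simps)
    show "\<exists>M. \<forall>i\<ge>M. \<forall>j\<ge>M. dist (s i) (s j) < e"
    proof (intro exI allI impI)
      fix i j assume "i \<ge> Suc n" "j \<ge> Suc n"
      then have "\<bar>s i - s j\<bar> \<le> 1 / Suc m"
        unfolding s_def using *[of i] *[of j] n by blast
      then show "dist (s i) (s j) < e" using m by (simp add: dist_real_def)
    qed
  qed
  then obtain l where l: "s \<longlonglongrightarrow> l" using Cauchy_convergent convergent_def by blast
  have "(\<lambda>h. Q t h) \<midarrow>0\<rightarrow> l"
  proof (rule LIM_I)
    fix e :: real assume "e > 0"
    then obtain m where m: "1 / real (Suc m) < e" by (metis nat_approx_posE)
    obtain n where n: "\<And>h k. 0 < \<bar>h\<bar> \<and> \<bar>h\<bar> < 1 / Suc n \<and> 0 < \<bar>k\<bar> \<and> \<bar>k\<bar> < 1 / Suc n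
        \<Longrightarrow> \<bar>Q t h - Q t k\<bar> \<le> 1 / Suc m" using R by blast
    have "norm (Q t h - l) < e" if h: "h \<noteq> 0" "norm (h - 0) < 1 / Suc n" for h
    proof -
      have "\<forall>\<^sub>F i in sequentially. \<bar>Q t h - s i\<bar> \<le> 1 / Suc m"
        using eventually_ge_at_top[of "Suc n"]
      proof eventually_elim
        case (elim i)
        then show ?case unfolding s_def using h
          using elim by (intro n conjI) (simp_all add: frac_less2)
      qed
      moreover have "(\<lambda>i. \<bar>Q t h - s i\<bar>) \<longlonglongrightarrow> \<bar>Q t h - l\<bar>" by (intro tendsto_intros l)
      ultimately have "\<bar>Q t h - l\<bar> \<le> 1 / Suc m"
        by (intro tendsto_upperbound) auto
      then show ?thesis using m by simp
    qed
    moreover have "0 < 1 / real (Suc n)" by simp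
    ultimately show "\<exists>d>0. \<forall>x. x \<noteq> 0 \<and> norm (x - 0) < d \<longrightarrow> norm (Q t x - l) < e"
      by (intro exI[of _ "1 / real (Suc n)"]) simp
  qed
  then show "\<exists>l. (g has_real_derivative l) (at t)" unfolding DERIV_def Q_def by blast
qed

text \<open>
  The derivative has to be Borel measurable, not just almost everywhere equal to a Borel function,
  because the Bochner integral over \<^const>\<open>lborel\<close> of a function that is only Lebesgue measurable
  is \<open>0\<close>. On the Borel set where \<open>g\<close> is differentiable the derivative is a limit of continuous
  difference quotients; off this set \<^const>\<open>vector_derivative\<close> is the choice from an empty
  predicate, hence one fixed constant.
\<close>

lemma borel_measurable_vector_derivative:
  fixes g :: "real \<Rightarrow> real"
  assumes cont: "continuous_on UNIV g"
  shows "(\<lambda>t. vector_derivative g (at t)) \<in> borel_measurable borel"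
proof -
  define Q where "Q = (\<lambda>t h. (g (t + h) - g t) / h)"
  define S where "S = {t. \<exists>l. (g has_real_derivative l) (at t)}"
  define C where "C m n = {t. \<forall>h k. 0 < \<bar>h\<bar> \<and> \<bar>h\<bar> < 1 / Suc n \<and> 0 < \<bar>k\<bar> \<and> \<bar>k\<bar> < 1 / Suc n
        \<longrightarrow> \<bar>Q t h - Q t k\<bar> \<le> 1 / Suc m}" for m n :: nat
  have S_eq: "S = (\<Inter>m. \<Union>n. C m n)"
    unfolding S_def C_def differentiable_iff_Cauchy_quotients Q_def by blast
  have cQ: "continuous_on UNIV (\<lambda>t. Q t h)" for h
  proof (cases "h = 0")
    case False
    have "continuous_on UNIV (g \<circ> (\<lambda>t. t + h))"
      by (intro continuous_on_compose continuous_intros continuous_on_subset[OF cont]) auto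
    then show ?thesis
      unfolding Q_def o_def using False by (intro continuous_intros cont) auto
  qed (simp add: Q_def)
  have "closed (C m n)" for m n
    unfolding C_def by (intro closed_Collect_all closed_Collect_imp closed_Collect_le continuous_intros cQ) auto
  then have S: "S \<in> sets borel"
    unfolding S_eq by (intro sets.countable_INT'' sets.countable_UN) auto
  have gb: "g \<in> borel_measurable borel"
    using cont by (rule borel_measurable_continuous_onI)
  have eq: "vector_derivative g (at t) =
     (if t \<in> S then lim (\<lambda>i. Q t (1 / real (Suc i))) else (SOME l. False))" for t
  proof (cases "t \<in> S")
    case True
    then obtain l where l: "(g has_real_derivative l) (at t)" unfolding S_def by blast
    then have "(\<lambda>h. Q t h) \<midarrow>0\<rightarrow> l" unfolding DERIV_def Q_def .
    moreover have "filterlim (\<lambda>i. 1 / real (Suc i)) (at 0) sequentially"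
      unfolding filterlim_at using LIMSEQ_inverse_real_of_nat by (auto simp: inverse_eq_divide)
    ultimately have "(\<lambda>i. Q t (1 / real (Suc i))) \<longlonglongrightarrow> l"
      by (rule filterlim_compose)
    then have "lim (\<lambda>i. Q t (1 / real (Suc i))) = l" by (rule limI)
    moreover have "vector_derivative g (at t) = l"
      using l by (intro vector_derivative_at) (simp add: has_real_derivative_iff_has_vector_derivative)
    ultimately show ?thesis using True by simp
  next
    case False
    then have "\<not> (g has_vector_derivative l) (at t)" for l
      unfolding S_def by (auto simp: has_real_derivative_iff_has_vector_derivative)
    then show ?thesis using False unfolding vector_derivative_def by simp
  qed
  have "(\<lambda>t. lim (\<lambda>i. Q t (1 / real (Suc i)))) \<in> borel_measurable borel"
    unfolding Q_def by (intro borel_measurable_lim_metric) (use gb in measurable)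
  then show ?thesis unfolding eq using S by measurable
qed

text \<open>
  Rademacher's theorem on the line, together with the fundamental theorem of calculus. Adding a
  steep linear function turns \<open>g\<close> into a homeomorphism \<open>F\<close> whose inverse pushes Lebesgue measure
  forward to the measure \<open>A \<mapsto> \<lambda>(F(A))\<close>. Lipschitz maps preserve null sets, so this
  measure has a Radon-Nikodym density, and \<open>F\<close> is an indefinite integral of it. Lebesgue's
  differentiation theorem then identifies the density with the derivative.
\<close>

lemma Lipschitz_AE_derivative:
  fixes g :: "real \<Rightarrow> real"
  assumes lip: "L-lipschitz_on UNIV g"
  obtains h where "\<And>a b. a \<le> b \<Longrightarrow> (h has_integral (g b - g a)) {a..b}"
    and "AE t in lborel. (g has_real_derivative h t) (at t)"
proof -
  have L0: "L \<ge> 0" using lip by (rule lipschitz_on_nonneg)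
  have gl: "\<bar>g x - g y\<bar> \<le> L * \<bar>x - y\<bar>" for x y
    using lipschitz_onD[OF lip, of x y] by (simp add: dist_real_def)
  \<comment> \<open>The slope exceeds \<open>L\<close> by one so that \<open>F\<close> expands distances.\<close>
  define F where "F t = g t + (L + 1) * t" for t
  have Fexp: "b - a \<le> F b - F a" if "a \<le> b" for a b
    using gl[of b a] that unfolding F_def by (simp add: algebra_simps abs_if split: if_splits)
  have Flip: "\<bar>F x - F y\<bar> \<le> (2 * L + 1) * \<bar>x - y\<bar>" for x y
  proof -
    have "F x - F y = (g x - g y) + (L + 1) * (x - y)" by (simp add: F_def algebra_simps)
    also have "\<bar>\<dots>\<bar> \<le> L * \<bar>x - y\<bar> + (L + 1) * \<bar>x - y\<bar>"
      using gl[of x y] L0 abs_triangle_ineq[of "g x - g y" "(L + 1) * (x - y)"]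
      by (simp add: abs_mult)
    finally show ?thesis by (simp add: algebra_simps)
  qed
  have Fcont: "continuous_on A F" for A
    unfolding F_def
    by (intro continuous_intros continuous_on_subset[OF lipschitz_on_continuous_on[OF lip]]) auto
  have Fmono: "strict_mono F"
    by (rule strict_monoI) (use Fexp in \<open>smt (verit)\<close>)
  then have Finj: "inj F" by (rule strict_mono_imp_inj_on)
  have Fsurj: "\<exists>x. F x = y" for y
  proof -
    define r where "r = \<bar>y - F 0\<bar>"
    have "F (- r) \<le> y" "y \<le> F r" using Fexp[of "-r" 0] Fexp[of 0 r] unfolding r_def by linarith+
    moreover have "- r \<le> r" unfolding r_def by simp
    ultimately show ?thesis using IVT'[of F "-r" y r, OF _ _ _ Fcont] by blast
  qed
  define G where "G = inv F"
  have FG: "F (G y) = y" for y using Fsurj[of y] unfolding G_def by (metis f_inv_into_f rangeI)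
  have GF: "G (F x) = x" for x unfolding G_def using Finj by simp
  have "mono G"
    by (rule monoI) (metis FG Fmono strict_mono_less_eq)
  then have Gb: "G \<in> borel_measurable borel" by (rule borel_measurable_mono)
  define \<mu> where "\<mu> = distr lborel borel G"
  have vim: "G -` A = F ` A" for A using FG GF by (auto simp: image_iff) metis
  have sets\<mu>: "sets \<mu> = sets borel" unfolding \<mu>_def by simp
  have ac: "absolutely_continuous lborel \<mu>"
    unfolding absolutely_continuous_def
  proof
    fix N :: "real set" assume N: "N \<in> null_sets lborel"
    then have "negligible N"
      by (simp add: negligible_iff_null_sets null_sets_completionI)
    then have "negligible (F ` N)"
      using Flip by (intro negligible_locally_Lipschitz_image) (auto intro!: exI[of _ UNIV] exI[of _ "2 * L + 1"])
    moreover have "F ` N \<in> sets borel"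
      using measurable_sets[OF Gb, of N] N by (simp add: vim null_sets_def)
    ultimately have "emeasure lborel (F ` N) = 0"
      by (simp add: negligible_iff_null_sets null_sets_completion_iff null_setsD1)
    then show "N \<in> null_sets \<mu>"
      using N Gb unfolding \<mu>_def by (auto simp: null_sets_def emeasure_distr vim)
  qed
  obtain f where f: "f \<in> borel_measurable lborel" "density lborel f = \<mu>"
    using sigma_finite_measure.Radon_Nikodym[OF lborel.sigma_finite_measure_axioms ac] sets\<mu> by auto
  have f_int: "(\<integral>\<^sup>+t\<in>{a..b}. f t \<partial>lborel) = ennreal (F b - F a)" if "a \<le> b" for a b
  proof -
    have "(\<integral>\<^sup>+t\<in>{a..b}. f t \<partial>lborel) = emeasure \<mu> {a..b}"
      unfolding f(2)[symmetric] using f(1) by (simp add: emeasure_density)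
    also have "\<dots> = emeasure lborel (F ` {a..b})"
      unfolding \<mu>_def using Gb by (simp add: emeasure_distr vim)
    also have "F ` {a..b} = {F a..F b}"
    proof (intro equalityI subsetI)
      fix y assume y: "y \<in> {F a..F b}"
      then have "a \<le> G y" "G y \<le> b" using FG[of y] Fmono by (metis atLeastAtMost_iff strict_mono_less_eq)+
      then show "y \<in> F ` {a..b}" using FG[of y] by (metis atLeastAtMost_iff image_eqI)
    qed (use Fmono in \<open>auto simp: strict_mono_less_eq\<close>)
    finally show ?thesis using Fmono that by (simp add: strict_mono_less_eq)
  qed
  have AEfin: "AE t in lborel. f t \<noteq> \<infinity>"
  proof -
    have "AE t in lborel. t \<in> {- real n..real n} \<longrightarrow> f t \<noteq> \<infinity>" for n
    proof -
      have "AE t in lborel. f t * indicator {- real n..real n} t \<noteq> \<infinity>"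
        using f(1) f_int[of "- real n" "real n"] by (intro nn_integral_noteq_infinite) auto
      then show ?thesis by eventually_elim auto
    qed
    then have "AE t in lborel. \<forall>n. t \<in> {- real n..real n} \<longrightarrow> f t \<noteq> \<infinity>" unfolding AE_all_countable by blast
    then show ?thesis
    proof eventually_elim
      case (elim t)
      obtain n where "\<bar>t\<bar> \<le> real n" using real_arch_simple by blast
      then show ?case using elim by (auto simp: abs_le_iff)
    qed
  qed
  define p where "p t = enn2real (f t)" for t
  have pb: "p \<in> borel_measurable borel" unfolding p_def using f(1) by measurable
  have p_int: "(p has_integral (F b - F a)) {a..b}" if "a \<le> b" for a b
  proof -
    have "(\<integral>\<^sup>+t. ennreal (p t * indicator {a..b} t) \<partial>lborel) = (\<integral>\<^sup>+t\<in>{a..b}. f t \<partial>lborel)"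
    proof (rule nn_integral_cong_AE, use AEfin in eventually_elim)
      case (elim t)
      then show ?case unfolding p_def by (auto simp: indicator_def top.not_eq_extremum)
    qed
    moreover have "(\<lambda>t. p t * indicator {a..b} t) \<in> borel_measurable borel"
      using pb by measurable
    moreover have "0 \<le> p t * indicator {a..b} t" for t by (simp add: p_def)
    ultimately have "((\<lambda>t. p t * indicator {a..b} t) has_integral (F b - F a)) UNIV"
      using f_int[OF that] Fmono that
      by (intro nn_integral_has_integral) (auto simp: strict_mono_less_eq)
    moreover have "(\<lambda>t. p t * indicator {a..b} t) = (\<lambda>t. if t \<in> {a..b} then p t else 0)"
      by (auto simp: indicator_def)
    ultimately show ?thesis by (simp only: has_integral_restrict_UNIV)
  qed
  define h where "h t = p t - (L + 1)" for t
  have h_int: "(h has_integral (g b - g a)) {a..b}" if "a \<le> b" for a b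
  proof -
    have "((\<lambda>t. L + 1) has_integral (b - a) * (L + 1)) {a..b}"
      using has_integral_const_real[of "L+1" a b] that by simp
    from has_integral_diff[OF p_int[OF that] this] show ?thesis
      unfolding h_def F_def by (simp add: algebra_simps)
  qed
  have "h integrable_on cbox a b" for a b
    using h_int[of a b] by (cases "a \<le> b") (auto simp: integrable_on_def)
  from integrable_ccontinuous_explicit[OF this] obtain N where N: "negligible N"
    "\<And>x e. \<lbrakk>x \<notin> N; 0 < e\<rbrakk> \<Longrightarrow> \<exists>d>0. \<forall>k. 0 < k \<and> k < d \<longrightarrow>
       norm (integral (cbox x (x + k *\<^sub>R One)) h /\<^sub>R k ^ DIM(real) - h x) < e" by metis
  \<comment> \<open>Averages of \<open>h\<close> over the intervals \<open>{x..x + k}\<close> control right derivatives only. Left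
    derivatives of \<open>g\<close> are, up to sign, right derivatives of its reflection.\<close>
  have h_int': "((\<lambda>t. h (- t)) has_integral (g (-a) - g (-b))) {a..b}" if "a \<le> b" for a b
    using h_int[of "-b" "-a"] that
      has_integral_reflect_real[of h "g (- a) - g (- b)" "- a" "- b"] by simp
  have "(\<lambda>t. h (- t)) integrable_on cbox a b" for a b
    using h_int'[of a b] by (cases "a \<le> b") (auto simp: integrable_on_def)
  from integrable_ccontinuous_explicit[OF this] obtain N' where N': "negligible N'"
    "\<And>x e. \<lbrakk>x \<notin> N'; 0 < e\<rbrakk> \<Longrightarrow> \<exists>d>0. \<forall>k. 0 < k \<and> k < d \<longrightarrow>
       norm (integral (cbox x (x + k *\<^sub>R One)) (\<lambda>t. h (- t)) /\<^sub>R k ^ DIM(real) - h (- x)) < e" by metis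
  have der: "(g has_real_derivative h t) (at t)" if t: "t \<notin> N" "- t \<notin> N'" for t
    unfolding DERIV_def
  proof (rule LIM_I)
    fix e :: real assume e: "e > 0"
    obtain d1 where d1: "d1 > 0" "\<And>k. 0 < k \<and> k < d1 \<Longrightarrow> norm (integral (cbox t (t + k *\<^sub>R One)) h /\<^sub>R k ^ DIM(real) - h t) < e"
      using N(2)[OF t(1) e] by blast
    obtain d2 where d2: "d2 > 0" "\<And>k. 0 < k \<and> k < d2 \<Longrightarrow> norm (integral (cbox (-t) (-t + k *\<^sub>R One)) (\<lambda>t. h (- t)) /\<^sub>R k ^ DIM(real) - h t) < e"
      using N'(2)[OF t(2) e] by auto
    have "norm ((g (t + k) - g t) / k - h t) < e" if k: "k \<noteq> 0" "norm (k - 0) < min d1 d2" for k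
    proof (cases "k > 0")
      case True
      have "integral {t..t + k} h = g (t + k) - g t" using h_int[of t "t + k"] True by (simp add: integral_unique)
      then show ?thesis using d1(2)[of k] True k by (simp add: divide_inverse mult.commute)
    next
      case False
      have "((\<lambda>t. h (- t)) has_integral (g t - g (t + k))) {-t..-t + (-k)}"
        using h_int'[of "-t" "-t + (-k)"] False by (simp add: add.commute)
      then have "integral {-t..-t + (-k)} (\<lambda>t. h (- t)) = g t - g (t + k)"
        by (rule integral_unique)
      moreover have "norm (integral {-t..-t + (-k)} (\<lambda>t. h (- t)) / (-k) - h t) < e"
        using d2(2)[of "-k"] False k by (simp add: divide_inverse mult.commute)
      moreover have "(g t - g (t + k)) / (-k) = (g (t + k) - g t) / k"
        using k by (simp add: field_simps)
      ultimately show ?thesis by simp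
    qed
    then show "\<exists>d>0. \<forall>k. k \<noteq> 0 \<and> norm (k - 0) < d \<longrightarrow> norm ((g (t + k) - g t) / k - h t) < e"
      using d1(1) d2(1) by (intro exI[of _ "min d1 d2"]) auto
  qed
  have "negligible (N \<union> uminus ` N')"
    using N(1) N'(1)
    by (intro negligible_Un negligible_locally_Lipschitz_image
          exI[of _ UNIV] exI[of _ "1 :: real"]) auto
  then have "AE t in lebesgue. t \<notin> N \<union> uminus ` N'"
    by (intro AE_not_in) (simp add: negligible_iff_null_sets)
  then have "AE t in lebesgue. (g has_real_derivative h t) (at t)"
    by eventually_elim (use der in force)
  then have "AE t in lborel. (g has_real_derivative h t) (at t)"
    by (simp add: AE_completion_iff)
  then show thesis using h_int by (intro that)
qed

section \<open>Derivatives on the unit interval\<close>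

definition unit_lborel :: "real measure" where
  "unit_lborel = restrict_space lborel {0..1}"

text \<open>
  Both partial derivatives of a function on the square are of this form, for a section of the
  function.
\<close>

definition deriv01 :: "(real \<Rightarrow> real) \<Rightarrow> real \<Rightarrow> real" where
  "deriv01 f t = vector_derivative f (at t within {0..1})"

lemma space_unit_lborel [simp]: "space unit_lborel = {0..1}"
  by (simp add: unit_lborel_def space_restrict_space)

lemma AE_unit_lborel: "(AE t in unit_lborel. P t) \<longleftrightarrow> (AE t in lborel. t \<in> {0..1} \<longrightarrow> P t)"
  unfolding unit_lborel_def by (intro AE_restrict_space_iff) simp

lemma AE_unit_lborelI: "(\<And>t. t \<in> {0..1} \<Longrightarrow> P t) \<Longrightarrow> AE t in unit_lborel. P t"
  by (rule AE_I2) simp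

lemma borel_measurable_unit_lborelI: "f \<in> borel_measurable borel \<Longrightarrow> f \<in> borel_measurable unit_lborel"
  unfolding unit_lborel_def by (intro measurable_restrict_space1) simp

lemma finite_measure_unit_lborel: "finite_measure unit_lborel"
  by (intro finite_measureI) (simp add: unit_lborel_def emeasure_restrict_space space_restrict_space)

lemma set_integral_unit: "(LBINT t:{0..1}. f t) = (\<integral>t. f t \<partial>unit_lborel)" for f :: "real \<Rightarrow> real"
  unfolding set_lebesgue_integral_def unit_lborel_def by (subst integral_restrict_space) auto

lemma integrable_unit_lborel_bounded:
  fixes f :: "real \<Rightarrow> real"
  assumes "f \<in> borel_measurable unit_lborel" "AE t in unit_lborel. \<bar>f t\<bar> \<le> K"
  shows "integrable unit_lborel f"
  by (rule finite_measure.integrable_const_bound[OF finite_measure_unit_lborel]) (use assms in auto)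

lemma deriv01_eqI:
  assumes "(f has_real_derivative l) (at t within {0..1})" "t \<in> {0..1}"
  shows "deriv01 f t = l"
  unfolding deriv01_def
  by (rule vector_derivative_within_closed_interval)
     (use assms in \<open>auto simp: has_real_derivative_iff_has_vector_derivative\<close>)

lemma deriv01_cong:
  assumes "\<And>s. s \<in> {0..1} \<Longrightarrow> f s = g s" "t \<in> {0..1}"
  shows "deriv01 f t = deriv01 g t"
proof -
  have "(f has_vector_derivative l) (at t within {0..1}) \<longleftrightarrow>
        (g has_vector_derivative l) (at t within {0..1})" for l
    using assms has_vector_derivative_transform[of t "{0..1}" f g l]
      has_vector_derivative_transform[of t "{0..1}" g f l] by auto
  then show ?thesis unfolding deriv01_def vector_derivative_def by simp
qed

text \<open>
  Precomposition with the retraction of the line onto the unit interval extends a Lipschitz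
  function to the whole line, so that the results on the line become available.
\<close>

lemma clamp_lipschitz:
  fixes f :: "real \<Rightarrow> real"
  assumes "L-lipschitz_on {0..1} f"
  shows "L-lipschitz_on UNIV (\<lambda>t. f (max 0 (min 1 t)))"
proof (rule lipschitz_onI)
  fix x y :: real
  have "dist (f (max 0 (min 1 x))) (f (max 0 (min 1 y))) \<le> L * dist (max 0 (min 1 x)) (max 0 (min 1 y))"
    by (rule lipschitz_onD[OF assms]) auto
  also have "\<dots> \<le> L * dist x y"
    using lipschitz_on_nonneg[OF assms]
    by (intro mult_left_mono) (auto simp: dist_real_def)
  finally show "dist (f (max 0 (min 1 x))) (f (max 0 (min 1 y))) \<le> L * dist x y" .
qed (rule lipschitz_on_nonneg[OF assms])

lemma has_vector_derivative_clamp: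
  fixes f :: "real \<Rightarrow> real"
  assumes "0 < t" "t < 1"
  shows "((\<lambda>t. f (max 0 (min 1 t))) has_vector_derivative l) (at t) \<longleftrightarrow>
         (f has_vector_derivative l) (at t within {0..1})"
proof -
  have "at t within {0..1} = at t" using assms by (intro at_within_Icc_at)
  moreover have "eventually (\<lambda>s. s \<in> {0<..<1}) (nhds t)"
    using assms by (intro eventually_nhds_in_open) auto
  then have "eventually (\<lambda>s. s \<in> UNIV \<longrightarrow> f (max 0 (min 1 s)) = f s) (nhds t)"
    by eventually_elim auto
  ultimately show ?thesis
    using has_vector_derivative_cong_ev[of UNIV "\<lambda>t. f (max 0 (min 1 t))" f t l] assms by auto
qed

lemma borel_measurable_deriv01:
  assumes lip: "L-lipschitz_on {0..1} f"
  shows "deriv01 f \<in> borel_measurable unit_lborel"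
proof -
  define g where "g t = f (max 0 (min 1 t))" for t
  have "continuous_on UNIV g"
    unfolding g_def by (rule lipschitz_on_continuous_on[OF clamp_lipschitz[OF lip]])
  then have "(\<lambda>t. vector_derivative g (at t)) \<in> borel_measurable borel"
    by (rule borel_measurable_vector_derivative)
  then have "(\<lambda>t. if t \<in> {0<..<1} then vector_derivative g (at t)
      else if t = 0 then deriv01 f 0 else deriv01 f 1) \<in> borel_measurable borel"
    by measurable
  then have "(\<lambda>t. if t \<in> {0<..<1} then vector_derivative g (at t)
      else if t = 0 then deriv01 f 0 else deriv01 f 1) \<in> borel_measurable unit_lborel"
    by (rule borel_measurable_unit_lborelI)
  also have "?this \<longleftrightarrow> ?thesis"
  proof (rule measurable_cong)
    fix t assume t: "t \<in> space unit_lborel"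
    have "vector_derivative g (at t) = deriv01 f t" if "0 < t" "t < 1"
      unfolding deriv01_def vector_derivative_def g_def
      using has_vector_derivative_clamp[OF that, of f] by simp
    then show "(if t \<in> {0<..<1} then vector_derivative g (at t)
      else if t = 0 then deriv01 f 0 else deriv01 f 1) = deriv01 f t"
      using t by auto
  qed
  finally show ?thesis .
qed

text \<open>
  The clamped extension has the same derivative as \<open>f\<close> at the interior points of the unit
  interval, and the two end points form a null set.
\<close>

lemma deriv01_density:
  assumes lip: "L-lipschitz_on {0..1} f"
  obtains h where "\<And>a b. 0 \<le> a \<Longrightarrow> a \<le> b \<Longrightarrow> b \<le> 1 \<Longrightarrow> (h has_integral (f b - f a)) {a..b}"
    and "AE t in unit_lborel. deriv01 f t = h t"
    and "AE t in unit_lborel. (f has_real_derivative deriv01 f t) (at t within {0..1})"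
proof -
  define g where "g t = f (max 0 (min 1 t))" for t
  obtain h where h: "\<And>a b. a \<le> b \<Longrightarrow> (h has_integral (g b - g a)) {a..b}"
    "AE t in lborel. (g has_real_derivative h t) (at t)"
    by (rule Lipschitz_AE_derivative[OF clamp_lipschitz[OF lip], folded g_def]) (rule that)
  have "AE t in lborel. t \<noteq> 0" "AE t in lborel. t \<noteq> (1::real)"
    by (rule AE_lborel_singleton)+
  with h(2) have *: "AE t in lborel. t \<in> {0..1} \<longrightarrow> (f has_real_derivative h t) (at t within {0..1})"
  proof eventually_elim
    case (elim t)
    then show ?case unfolding g_def
      using has_vector_derivative_clamp[of t f "h t"]
      by (auto simp: has_real_derivative_iff_has_vector_derivative)
  qed
  show thesis
  proof (rule that)
    fix a b :: real assume "0 \<le> a" "a \<le> b" "b \<le> 1"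
    then show "(h has_integral (f b - f a)) {a..b}" using h(1)[of a b] unfolding g_def by simp
  next
    show "AE t in unit_lborel. deriv01 f t = h t"
      unfolding AE_unit_lborel using * by eventually_elim (use deriv01_eqI in blast)
    show "AE t in unit_lborel. (f has_real_derivative deriv01 f t) (at t within {0..1})"
      unfolding AE_unit_lborel using * by eventually_elim (use deriv01_eqI in force)
  qed
qed

lemma AE_has_deriv01:
  assumes "L-lipschitz_on {0..1} f"
  shows "AE t in unit_lborel. (f has_real_derivative deriv01 f t) (at t within {0..1})"
  by (rule deriv01_density[OF assms])

lemma AE_deriv01_le:
  assumes lip: "L-lipschitz_on {0..1} f"
  shows "AE t in unit_lborel. \<bar>deriv01 f t\<bar> \<le> L"
  using AE_has_deriv01[OF lip] AE_space
proof eventually_elim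
  case (elim t)
  then have t: "t \<in> {0..1}" by simp
  have "((\<lambda>y. \<bar>(f y - f t) / (y - t)\<bar>) \<longlongrightarrow> \<bar>deriv01 f t\<bar>) (at t within {0..1})"
    using elim(1) unfolding has_field_derivative_iff by (rule tendsto_rabs)
  moreover have "\<forall>\<^sub>F y in at t within {0..1}. \<bar>(f y - f t) / (y - t)\<bar> \<le> L"
    unfolding eventually_at_filter
    by (rule always_eventually)
       (use lipschitz_onD[OF lip, of _ t] t in \<open>auto simp: dist_real_def divide_le_eq abs_divide\<close>)
  moreover have "at t within {0..1} \<noteq> bot"
    using t by (simp add: trivial_limit_within islimpt_Icc)
  ultimately show ?case by (intro tendsto_upperbound)
qed

lemma AE_deriv01_nonneg:
  assumes lip: "L-lipschitz_on {0..1} f" and mono: "mono_on {0..1} f"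
  shows "AE t in unit_lborel. 0 \<le> deriv01 f t"
  using AE_has_deriv01[OF lip] AE_space
proof eventually_elim
  case (elim t)
  then have t: "t \<in> {0..1}" by simp
  have "((\<lambda>y. (f y - f t) / (y - t)) \<longlongrightarrow> deriv01 f t) (at t within {0..1})"
    using elim(1) unfolding has_field_derivative_iff .
  moreover have "\<forall>\<^sub>F y in at t within {0..1}. 0 \<le> (f y - f t) / (y - t)"
    unfolding eventually_at_filter
  proof (rule always_eventually, intro allI impI)
    fix y :: real assume "y \<noteq> t" "y \<in> {0..1}"
    then show "0 \<le> (f y - f t) / (y - t)"
      using mono_onD[OF mono, of y t] mono_onD[OF mono, of t y] t
      by (cases "y < t") (auto simp: divide_nonpos_nonpos divide_nonneg_nonneg)
  qed
  moreover have "at t within {0..1} \<noteq> bot"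
    using t by (simp add: trivial_limit_within islimpt_Icc)
  ultimately show ?case by (intro tendsto_lowerbound)
qed

lemma integrable_deriv01_mult:
  assumes "L-lipschitz_on {0..1} f" "g \<in> borel_measurable unit_lborel" "AE t in unit_lborel. \<bar>g t\<bar> \<le> K"
  shows "integrable unit_lborel (\<lambda>t. deriv01 f t * g t)"
proof (rule integrable_unit_lborel_bounded)
  show "(\<lambda>t. deriv01 f t * g t) \<in> borel_measurable unit_lborel"
    using borel_measurable_deriv01[OF assms(1)] assms(2) by measurable
  show "AE t in unit_lborel. \<bar>deriv01 f t * g t\<bar> \<le> L * K"
    using AE_deriv01_le[OF assms(1)] assms(3)
    by eventually_elim (auto simp: abs_mult intro!: mult_mono)
qed

text \<open>
  The fundamental theorem of calculus for Lipschitz functions: the derivative agrees almost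
  everywhere with a density whose integrals are the increments.
\<close>

lemma integral_deriv01:
  assumes lip: "L-lipschitz_on {0..1} f" and ab: "0 \<le> a" "a \<le> b" "b \<le> 1"
  shows "(\<integral>t. deriv01 f t * indicator {a..b} t \<partial>unit_lborel) = f b - f a"
proof -
  define k where "k t = indicator {0..1} t *\<^sub>R (deriv01 f t * indicator {a..b} t)" for t
  obtain h where h: "\<And>a b. 0 \<le> a \<Longrightarrow> a \<le> b \<Longrightarrow> b \<le> 1 \<Longrightarrow> (h has_integral (f b - f a)) {a..b}"
    "AE t in unit_lborel. deriv01 f t = h t"
    by (rule deriv01_density[OF lip]) (rule that)
  have "integrable unit_lborel (\<lambda>t. deriv01 f t * indicator {a..b} t)"
    by (rule integrable_deriv01_mult[OF lip, where K = 1])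
       (auto intro!: borel_measurable_unit_lborelI simp: indicator_def)
  then have "integrable lborel k"
    unfolding k_def unit_lborel_def by (subst (asm) integrable_restrict_space) auto
  then have k: "(k has_integral (\<integral>t. k t \<partial>lborel)) UNIV"
    by (rule has_integral_integral_lborel)
  obtain N where N: "\<And>t. t \<in> space lborel - N \<Longrightarrow> t \<in> {0..1} \<longrightarrow> deriv01 f t = h t"
      "N \<in> null_sets lborel"
    by (rule AE_E3[OF h(2)[unfolded AE_unit_lborel]]) (rule that)
  have "negligible N" using N(2) by (simp add: negligible_iff_null_sets null_sets_completionI)
  moreover have "k t = (if t \<in> {a..b} then h t else 0)" if "t \<in> UNIV - N" for t
    using N(1)[of t] that ab unfolding k_def by (auto simp: indicator_def)
  moreover have "((\<lambda>t. if t \<in> {a..b} then h t else 0) has_integral (f b - f a)) UNIV"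
    using h(1)[OF ab] by (simp only: has_integral_restrict_UNIV)
  ultimately have "(k has_integral (f b - f a)) UNIV"
    by (rule has_integral_spike)
  with k have "(\<integral>t. k t \<partial>lborel) = f b - f a" by (rule has_integral_unique)
  then show ?thesis unfolding k_def unit_lborel_def by (subst integral_restrict_space) auto
qed

lemma integral_deriv01_unit:
  assumes lip: "L-lipschitz_on {0..1} f"
  shows "(\<integral>t. deriv01 f t \<partial>unit_lborel) = f 1 - f 0"
proof -
  have "(\<integral>t. deriv01 f t \<partial>unit_lborel) = (\<integral>t. deriv01 f t * indicator {0..1} t \<partial>unit_lborel)"
    by (rule Bochner_Integration.integral_cong) auto
  then show ?thesis using integral_deriv01[OF lip, of 0 1] by simp
qed

lemma AE_deriv01_lincomb:
  assumes f: "L-lipschitz_on {0..1} f" and g: "M-lipschitz_on {0..1} g"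
    and h: "\<And>t. t \<in> {0..1} \<Longrightarrow> h t = a * f t + b * g t"
  shows "AE t in unit_lborel. deriv01 h t = a * deriv01 f t + b * deriv01 g t"
  using AE_has_deriv01[OF f] AE_has_deriv01[OF g] AE_space
proof eventually_elim
  case (elim t)
  have "((\<lambda>t. a * f t + b * g t) has_real_derivative (a * deriv01 f t + b * deriv01 g t)) (at t within {0..1})"
    by (intro DERIV_add DERIV_cmult elim)
  then have "deriv01 (\<lambda>t. a * f t + b * g t) t = a * deriv01 f t + b * deriv01 g t"
    by (rule deriv01_eqI) (use elim in simp)
  moreover have "deriv01 h t = deriv01 (\<lambda>t. a * f t + b * g t) t"
    by (rule deriv01_cong) (use h elim in auto)
  ultimately show ?case by simp
qed

section \<open>Essentially bounded functions\<close>

text \<open>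
  Membership in \<open>L\<^sup>\<infinity>\<close> of the unit interval. The bound is required only almost everywhere because
  a Lipschitz constant bounds \<^const>\<open>deriv01\<close> only where the function is differentiable.
\<close>

definition bdd_measurable :: "(real \<Rightarrow> real) \<Rightarrow> bool" where
  "bdd_measurable \<phi> \<longleftrightarrow>
     \<phi> \<in> borel_measurable unit_lborel \<and> (\<exists>K. AE t in unit_lborel. \<bar>\<phi> t\<bar> \<le> K)"

lemma bdd_measurable_borel: "bdd_measurable \<phi> \<Longrightarrow> \<phi> \<in> borel_measurable unit_lborel"
  by (simp add: bdd_measurable_def)

lemma bdd_measurable_integrable: "bdd_measurable \<phi> \<Longrightarrow> integrable unit_lborel \<phi>"
  unfolding bdd_measurable_def by (auto intro: integrable_unit_lborel_bounded)

lemma bdd_measurable_add: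
  assumes "bdd_measurable \<phi>" "bdd_measurable \<psi>"
  shows "bdd_measurable (\<lambda>t. \<phi> t + \<psi> t)"
proof -
  obtain K L where KL: "AE t in unit_lborel. \<bar>\<phi> t\<bar> \<le> K" "AE t in unit_lborel. \<bar>\<psi> t\<bar> \<le> L"
    using assms unfolding bdd_measurable_def by blast
  have "AE t in unit_lborel. \<bar>\<phi> t + \<psi> t\<bar> \<le> K + L"
    using KL by eventually_elim linarith
  then show ?thesis using assms unfolding bdd_measurable_def by auto
qed

lemma bdd_measurable_mult:
  assumes "bdd_measurable \<phi>" "bdd_measurable \<psi>"
  shows "bdd_measurable (\<lambda>t. \<phi> t * \<psi> t)"
proof -
  obtain K L where KL: "AE t in unit_lborel. \<bar>\<phi> t\<bar> \<le> K" "AE t in unit_lborel. \<bar>\<psi> t\<bar> \<le> L"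
    using assms unfolding bdd_measurable_def by blast
  have "AE t in unit_lborel. \<bar>\<phi> t * \<psi> t\<bar> \<le> K * L"
    using KL by eventually_elim (auto simp: abs_mult intro!: mult_mono)
  then show ?thesis using assms unfolding bdd_measurable_def by auto
qed

lemma bdd_measurable_const: "bdd_measurable (\<lambda>t. c)"
  unfolding bdd_measurable_def by auto

lemma bdd_measurable_cmult: "bdd_measurable \<phi> \<Longrightarrow> bdd_measurable (\<lambda>t. c * \<phi> t)"
  by (intro bdd_measurable_mult bdd_measurable_const)

lemma bdd_measurable_diff:
  "bdd_measurable \<phi> \<Longrightarrow> bdd_measurable \<psi> \<Longrightarrow> bdd_measurable (\<lambda>t. \<phi> t - \<psi> t)"
  using bdd_measurable_add[of \<phi> "\<lambda>t. -1 * \<psi> t"] bdd_measurable_cmult[of \<psi> "-1"] by simp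

lemma bdd_measurable_indicator_borel: "A \<in> sets borel \<Longrightarrow> bdd_measurable (indicator A)"
  unfolding bdd_measurable_def
  by (intro conjI borel_measurable_unit_lborelI borel_measurable_indicator exI[of _ 1])
     (auto simp: indicator_def)

lemma bdd_measurable_abs: "bdd_measurable \<phi> \<Longrightarrow> bdd_measurable (\<lambda>t. \<bar>\<phi> t\<bar>)"
  unfolding bdd_measurable_def by auto

lemma bdd_measurable_deriv01: "L-lipschitz_on {0..1} f \<Longrightarrow> bdd_measurable (deriv01 f)"
  unfolding bdd_measurable_def using borel_measurable_deriv01 AE_deriv01_le by blast

text \<open>
  Two linear functionals on \<open>L\<^sup>\<infinity>\<close> that are bounded in the \<open>L\<^sup>1\<close> norm agree as soon as they agree
  on the indicator functions of the intervals \<open>{0..y}\<close>, because step functions are dense in \<open>L\<^sup>1\<close>.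
  The lemma is applied to a difference of such functionals. Dominated convergence makes the kernel
  closed under dominated pointwise limits. Hence the sets whose indicator function lies in the kernel
  form a Dynkin system; it contains a generator of the Borel sets that is closed under intersections,
  so all Borel sets. Simple functions and their limits follow.
\<close>

lemma L1_bounded_functional_eq_0:
  fixes E :: "(real \<Rightarrow> real) \<Rightarrow> real"
  assumes add: "\<And>\<phi> \<psi>. bdd_measurable \<phi> \<Longrightarrow> bdd_measurable \<psi> \<Longrightarrow> E (\<lambda>t. \<phi> t + \<psi> t) = E \<phi> + E \<psi>"
    and cmult: "\<And>c \<phi>. bdd_measurable \<phi> \<Longrightarrow> E (\<lambda>t. c * \<phi> t) = c * E \<phi>"
    and bound: "\<And>\<phi>. bdd_measurable \<phi> \<Longrightarrow> \<bar>E \<phi>\<bar> \<le> K * (\<integral>t. \<bar>\<phi> t\<bar> \<partial>unit_lborel)"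
    and base: "\<And>y. y \<in> {0..1} \<Longrightarrow> E (indicator {0..y}) = 0"
    and \<phi>: "bdd_measurable \<phi>"
  shows "E \<phi> = 0"
proof -
  have diff: "E (\<lambda>t. \<phi> t - \<psi> t) = E \<phi> - E \<psi>" if "bdd_measurable \<phi>" "bdd_measurable \<psi>" for \<phi> \<psi>
    using add[OF that(1) bdd_measurable_cmult[OF that(2), of "-1"]] cmult[OF that(2), of "-1"] by simp
  have lim: "E \<phi> = 0"
    if \<phi>: "bdd_measurable \<phi>" and s: "\<And>n. bdd_measurable (s n)" "\<And>n. E (s n) = 0"
      and conv: "\<And>t. t \<in> {0..1} \<Longrightarrow> (\<lambda>n. s n t) \<longlonglongrightarrow> \<phi> t"
      and dom: "\<And>n t. t \<in> {0..1} \<Longrightarrow> \<bar>s n t\<bar> \<le> w t" and w: "integrable unit_lborel w"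
    for \<phi> and s :: "nat \<Rightarrow> real \<Rightarrow> real" and w
  proof -
    have "(\<lambda>n. \<integral>t. \<bar>s n t - \<phi> t\<bar> \<partial>unit_lborel) \<longlonglongrightarrow> (\<integral>t. 0 \<partial>unit_lborel)"
    proof (rule integral_dominated_convergence)
      show "integrable unit_lborel (\<lambda>t. w t + \<bar>\<phi> t\<bar>)"
        using w bdd_measurable_integrable[OF \<phi>] by auto
      show "(\<lambda>t. \<bar>s n t - \<phi> t\<bar>) \<in> borel_measurable unit_lborel" for n
        using bdd_measurable_borel[OF s(1)[of n]] bdd_measurable_borel[OF \<phi>] by measurable
      show "AE t in unit_lborel. (\<lambda>n. \<bar>s n t - \<phi> t\<bar>) \<longlonglongrightarrow> 0"
      proof (rule AE_unit_lborelI)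
        fix t :: real assume "t \<in> {0..1}"
        then have "(\<lambda>n. s n t - \<phi> t) \<longlonglongrightarrow> 0" using conv by (simp add: LIM_zero)
        then show "(\<lambda>n. \<bar>s n t - \<phi> t\<bar>) \<longlonglongrightarrow> 0" by (rule tendsto_rabs_zero)
      qed
      show "AE t in unit_lborel. norm \<bar>s n t - \<phi> t\<bar> \<le> w t + \<bar>\<phi> t\<bar>" for n
      proof (rule AE_unit_lborelI)
        fix t :: real assume "t \<in> {0..1}"
        then show "norm \<bar>s n t - \<phi> t\<bar> \<le> w t + \<bar>\<phi> t\<bar>"
          using dom[of t n] by (simp add: abs_le_iff) linarith
      qed
    qed simp
    then have "(\<lambda>n. K * (\<integral>t. \<bar>s n t - \<phi> t\<bar> \<partial>unit_lborel)) \<longlonglongrightarrow> K * 0"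
      by (intro tendsto_intros) simp
    moreover have "\<bar>E \<phi>\<bar> \<le> K * (\<integral>t. \<bar>s n t - \<phi> t\<bar> \<partial>unit_lborel)" for n
      using bound[OF bdd_measurable_diff[OF s(1)[of n] \<phi>]] diff[OF s(1)[of n] \<phi>] s(2)[of n] by simp
    ultimately have "\<bar>E \<phi>\<bar> \<le> K * 0" by (intro LIMSEQ_le_const) auto
    then show ?thesis by simp
  qed
  \<comment> \<open>Values outside the unit interval do not matter: apply \<open>lim\<close> to a constant sequence.\<close>
  have cong: "E \<phi> = 0" if "bdd_measurable \<phi>" "bdd_measurable \<psi>" "E \<psi> = 0" "\<And>t. t \<in> {0..1} \<Longrightarrow> \<phi> t = \<psi> t" for \<phi> \<psi>
    by (rule lim[of \<phi> "\<lambda>_. \<psi>" "\<lambda>t. \<bar>\<psi> t\<bar>"])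
       (use that bdd_measurable_integrable[OF bdd_measurable_abs[OF that(2)]] in auto)
  have zero: "E (\<lambda>t. 0) = 0" using cmult[OF bdd_measurable_const[of 0], of 0] by simp
  have one: "E (indicator UNIV) = 0"
    by (rule cong[OF _ _ base[of 1]]) (simp_all add: bdd_measurable_indicator_borel bdd_measurable_const)
  have borel: "E (indicator A) = 0" if A: "A \<in> sets borel" for A :: "real set"
  proof -
    have Int: "Int_stable (range (\<lambda>a. {..a :: real}))"
      by (auto simp: Int_stable_def)
    have Pow: "range (\<lambda>a. {..a :: real}) \<subseteq> Pow UNIV" by simp
    have "A \<in> sigma_sets UNIV (range (\<lambda>a. {..a :: real}))"
      using A unfolding borel_eq_atMost by (simp add: sets_measure_of)
    then show ?thesis
    proof (induction rule: sigma_sets_induct_disjoint[OF Int Pow, consumes 1, case_names basic empty compl union])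
      case (basic A)
      then obtain a where A: "A = {..a}" by blast
      consider "a < 0" | "a \<in> {0..1}" | "a > 1" by fastforce
      then show ?case
      proof cases
        case 1
        then show ?thesis unfolding A
          by (intro cong[OF bdd_measurable_indicator_borel bdd_measurable_const zero])
             (auto simp: indicator_def)
      next
        case 2
        then show ?thesis unfolding A
          by (intro cong[OF bdd_measurable_indicator_borel bdd_measurable_indicator_borel base[of a]])
             (auto simp: indicator_def)
      next
        case 3
        then show ?thesis unfolding A
          by (intro cong[OF bdd_measurable_indicator_borel bdd_measurable_indicator_borel one])
             (auto simp: indicator_def)
      qed
    next
      case empty
      have "indicator {} = (\<lambda>t::real. 0::real)" by auto
      then show ?case using zero by simp
    next
      case (compl A)
      then have "A \<in> sets borel" unfolding borel_eq_atMost by (simp add: sets_measure_of)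
      then have "bdd_measurable (indicator A)" by (rule bdd_measurable_indicator_borel)
      then have "E (\<lambda>t. indicator UNIV t - indicator A t) = 0"
        using diff[of "indicator UNIV" "indicator A"] one compl
        by (simp add: bdd_measurable_const)
      moreover have "(\<lambda>t. indicator UNIV t - indicator A t :: real) = indicator (UNIV - A)"
        by (auto simp: indicator_def)
      ultimately show ?case by simp
    next
      case (union A)
      have Ab: "A n \<in> sets borel" for n
        using union(2) unfolding borel_eq_atMost by (auto simp: sets_measure_of)
      define s where "s n = (\<lambda>t. \<Sum>i<n. indicator (A i) t :: real)" for n :: nat
      have s: "bdd_measurable (s n) \<and> E (s n) = 0" for n
      proof (induction n)
        case 0
        then show ?case using zero bdd_measurable_const[of 0] by (simp add: s_def)
      next
        case (Suc n)
        then show ?case unfolding s_def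
          using add[of "s n" "indicator (A n)"] bdd_measurable_add[of "s n" "indicator (A n)"]
            bdd_measurable_indicator_borel[OF Ab[of n]] union(3)[of n]
          by (simp add: s_def)
      qed
      have s_eq: "s n = indicator (\<Union>i<n. A i)" for n
      proof
        fix t
        show "s n t = indicator (\<Union>i<n. A i) t"
          unfolding s_def
          by (subst indicator_UN_disjoint) (use union(1) in \<open>auto simp: disjoint_family_on_def\<close>)
      qed
      show ?case
      proof (rule lim[of _ s "\<lambda>_. 1"])
        show "bdd_measurable (indicator (\<Union> (range A)))"
          by (rule bdd_measurable_indicator_borel) (use Ab in auto)
        show "(\<lambda>n. s n t) \<longlonglongrightarrow> indicator (\<Union> (range A)) t" for t
          unfolding s_eq by (rule LIMSEQ_indicator_UN)
        show "\<bar>s n t\<bar> \<le> 1" for n t unfolding s_eq by (simp add: indicator_def)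
        show "integrable unit_lborel (\<lambda>_. 1::real)" by (rule bdd_measurable_integrable[OF bdd_measurable_const])
      qed (use s in auto)
    qed
  qed
  have simple: "bdd_measurable s \<and> E s = 0" if s: "simple_function unit_lborel s" for s
  proof -
    define S where "S y = (indicator (s -` {y} \<inter> {0..1}) :: real \<Rightarrow> real)" for y
    have S: "bdd_measurable (S y)" "E (S y) = 0" for y
    proof -
      have "s -` {y} \<inter> {0..1} \<in> sets borel"
        using simple_functionD(2)[OF s, of "{y}"] unfolding unit_lborel_def
        by (auto simp: sets_restrict_space_iff space_restrict_space)
      then show "bdd_measurable (S y)" "E (S y) = 0"
        unfolding S_def by (simp_all add: bdd_measurable_indicator_borel borel)
    qed
    have "bdd_measurable (\<lambda>t. \<Sum>y\<in>F. y * S y t) \<and> E (\<lambda>t. \<Sum>y\<in>F. y * S y t) = 0"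
      if "finite F" for F
      using that
    proof induction
      case empty
      then show ?case using zero bdd_measurable_const[of 0] by simp
    next
      case (insert x F)
      have "bdd_measurable (\<lambda>t. x * S x t)" "E (\<lambda>t. x * S x t) = 0"
        using cmult[OF S(1)[of x], of x] bdd_measurable_cmult[OF S(1)[of x], of x] S(2)[of x] by auto
      then show ?case
        using insert add[of "\<lambda>t. x * S x t" "\<lambda>t. \<Sum>y\<in>F. y * S y t"]
          bdd_measurable_add[of "\<lambda>t. x * S x t" "\<lambda>t. \<Sum>y\<in>F. y * S y t"]
        by simp
    qed
    then have *: "bdd_measurable (\<lambda>t. \<Sum>y\<in>s ` {0..1}. y * S y t) \<and>
          E (\<lambda>t. \<Sum>y\<in>s ` {0..1}. y * S y t) = 0"
      using simple_functionD(1)[OF s] by simp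
    have eq: "s t = (\<Sum>y\<in>s ` {0..1}. y * S y t)" if "t \<in> {0..1}" for t
    proof -
      have "(\<Sum>y\<in>s ` {0..1}. y * S y t) = (\<Sum>y\<in>s ` {0..1}. if y = s t then y else 0)"
        using that by (intro sum.cong) (auto simp: S_def indicator_def)
      also have "\<dots> = s t" using simple_functionD(1)[OF s] that by (simp add: sum.delta)
      finally show ?thesis by simp
    qed
    have "s \<in> borel_measurable unit_lborel" using s by (rule borel_measurable_simple_function)
    moreover obtain B where "\<forall>y\<in>s ` {0..1}. \<bar>y\<bar> \<le> B"
      using finite_imp_bounded[OF simple_functionD(1)[OF s]] by (auto simp: bounded_iff)
    then have "AE t in unit_lborel. \<bar>s t\<bar> \<le> B" by (intro AE_unit_lborelI) blast
    ultimately have "bdd_measurable s" unfolding bdd_measurable_def by blast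
    with cong[OF this _ _ eq] * show ?thesis by blast
  qed
  obtain s where s: "\<And>i. simple_function unit_lborel (s i)"
    "\<And>t. t \<in> {0..1} \<Longrightarrow> (\<lambda>i. s i t) \<longlonglongrightarrow> \<phi> t"
    "\<And>i t. t \<in> {0..1} \<Longrightarrow> dist (s i t) 0 \<le> 2 * dist (\<phi> t) 0"
    using borel_measurable_implies_sequence_metric[OF bdd_measurable_borel[OF \<phi>], of 0]
    unfolding space_unit_lborel by blast
  show ?thesis
    by (rule lim[OF \<phi>, of s "\<lambda>t. 2 * \<bar>\<phi> t\<bar>"])
       (use s simple bdd_measurable_integrable[OF bdd_measurable_abs[OF \<phi>]] in auto)
qed

section \<open>Copulas and the star product\<close>

lemma copula_zero: "copula C \<Longrightarrow> \<not> (x \<in> {0..1} \<and> y \<in> {0..1}) \<Longrightarrow> C x y = 0"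
  by (simp add: copula_def)

lemma copula_margins:
  assumes "copula C" "t \<in> {0..1}"
  shows "C t 0 = 0" "C t 1 = t" "C 0 t = 0" "C 1 t = t"
  using assms by (auto simp: copula_def)

lemma copula_rectangle:
  assumes "copula C" "x \<in> {0..1}" "u \<in> {0..1}" "y \<in> {0..1}" "v \<in> {0..1}" "x \<le> u" "y \<le> v"
  shows "C u v - C u y - C x v + C x y \<ge> 0"
  using assms unfolding copula_def by blast

text \<open>
  Transposition maps copulas to copulas and reverses star products, so every statement about one
  variable or one factor yields the corresponding statement about the other.
\<close>

definition flip :: "(real \<Rightarrow> real \<Rightarrow> real) \<Rightarrow> real \<Rightarrow> real \<Rightarrow> real" where
  "flip A = (\<lambda>x y. A y x)"

lemma flip_flip [simp]: "flip (flip A) = A"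
  by (simp add: flip_def)

lemma copula_flip: "copula C \<Longrightarrow> copula (flip C)"
  unfolding copula_def flip_def by (auto simp: algebra_simps)

text \<open>
  Rectangles that reach down to the first coordinate \<open>0\<close> show that the section increases;
  rectangles that reach up to \<open>1\<close>, where the section is the identity, show that it grows no faster
  than the identity.
\<close>

lemma copula_lipschitz:
  assumes C: "copula C" and x: "x \<in> {0..1}"
  shows "1-lipschitz_on {0..1} (C x)"
proof (rule lipschitz_on_leI)
  fix y v :: real assume yv: "y \<in> {0..1}" "v \<in> {0..1}" "y \<le> v"
  have "C x v - C x y \<ge> 0"
    using copula_rectangle[OF C, of 0 x y v] copula_margins[OF C] x yv by simp
  moreover have "C x v - C x y \<le> v - y"
    using copula_rectangle[OF C, of x 1 y v] copula_margins[OF C] x yv by simp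
  ultimately show "dist (C x y) (C x v) \<le> 1 * dist y v" using yv by (simp add: dist_real_def)
qed simp

lemma copula_lipschitz_flip:
  assumes "copula C" "y \<in> {0..1}"
  shows "1-lipschitz_on {0..1} (\<lambda>s. C s y)"
  using copula_lipschitz[OF copula_flip[OF assms(1)] assms(2)] by (simp add: flip_def)

lemma bdd_measurable_copula_section:
  assumes "copula C" "x \<in> {0..1}"
  shows "bdd_measurable (deriv01 (C x))" "bdd_measurable (deriv01 (\<lambda>s. C s x))"
  using assms bdd_measurable_deriv01 copula_lipschitz copula_lipschitz_flip by blast+

lemma star_prod_eq:
  assumes "x \<in> {0..1}" "y \<in> {0..1}"
  shows "(A \<star> B) x y = (\<integral>t. deriv01 (A x) t * deriv01 (\<lambda>s. B s y) t \<partial>unit_lborel)"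
  using assms unfolding star_prod_def partial1_def partial2_def deriv01_def
  by (simp add: set_integral_unit)

lemma star_prod_zero: "\<not> (x \<in> {0..1} \<and> y \<in> {0..1}) \<Longrightarrow> (A \<star> B) x y = 0"
  by (auto simp: star_prod_def)

lemma flip_star: "flip (A \<star> B) = flip B \<star> flip A"
  by (auto simp: fun_eq_iff flip_def star_prod_def partial1_def partial2_def mult.commute)

section \<open>The Markov operator of a copula\<close>

text \<open>
  The Markov operator that is usually attached to a copula \<open>B\<close> maps \<open>\<phi>\<close> to the derivative of this
  function of \<open>s\<close>. If \<open>\<phi>\<close> is the partial derivative \<open>\<partial>\<^sub>1C(\<cdot>, y)\<close>, then \<open>markov B \<phi>\<close> is the section
  \<open>(B \<star> C)(\<cdot>, y)\<close> of the star product.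
\<close>

definition markov :: "(real \<Rightarrow> real \<Rightarrow> real) \<Rightarrow> (real \<Rightarrow> real) \<Rightarrow> real \<Rightarrow> real" where
  "markov B \<phi> s = (\<integral>t. deriv01 (B s) t * \<phi> t \<partial>unit_lborel)"

lemma markov_integrable:
  assumes "copula B" "s \<in> {0..1}" "bdd_measurable \<phi>"
  shows "integrable unit_lborel (\<lambda>t. deriv01 (B s) t * \<phi> t)"
  by (intro bdd_measurable_integrable bdd_measurable_mult bdd_measurable_copula_section assms)

lemma markov_lincomb:
  assumes "copula B" "s \<in> {0..1}" "bdd_measurable \<phi>" "bdd_measurable \<psi>"
  shows "markov B (\<lambda>t. a * \<phi> t + b * \<psi> t) s = a * markov B \<phi> s + b * markov B \<psi> s"
proof -
  have "markov B (\<lambda>t. a * \<phi> t + b * \<psi> t) s =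
    (\<integral>t. a * (deriv01 (B s) t * \<phi> t) + b * (deriv01 (B s) t * \<psi> t) \<partial>unit_lborel)"
    unfolding markov_def by (intro Bochner_Integration.integral_cong) (auto simp: algebra_simps)
  also have "\<dots> = a * markov B \<phi> s + b * markov B \<psi> s"
    unfolding markov_def using markov_integrable assms by simp
  finally show ?thesis .
qed

lemma markov_margins:
  assumes B: "copula B"
  shows "markov B \<phi> 0 = 0" "markov B \<phi> 1 = (\<integral>t. \<phi> t \<partial>unit_lborel)"
proof -
  have 0: "deriv01 (B 0) t = 0" if t: "t \<in> {0..1}" for t
  proof -
    have "deriv01 (B 0) t = deriv01 (\<lambda>_. 0) t"
      by (rule deriv01_cong[OF _ t]) (use copula_margins(3)[OF B] in auto)
    also have "\<dots> = 0" by (rule deriv01_eqI[OF _ t]) auto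
    finally show ?thesis .
  qed
  have 1: "deriv01 (B 1) t = 1" if t: "t \<in> {0..1}" for t
  proof -
    have "deriv01 (B 1) t = deriv01 (\<lambda>t. t) t"
      by (rule deriv01_cong[OF _ t]) (use copula_margins(4)[OF B] in auto)
    also have "\<dots> = 1" by (rule deriv01_eqI[OF _ t]) auto
    finally show ?thesis .
  qed
  have "markov B \<phi> 0 = (\<integral>t. 0 \<partial>unit_lborel)"
    unfolding markov_def by (intro Bochner_Integration.integral_cong) (use 0 in auto)
  then show "markov B \<phi> 0 = 0" by simp
  show "markov B \<phi> 1 = (\<integral>t. \<phi> t \<partial>unit_lborel)"
    unfolding markov_def by (intro Bochner_Integration.integral_cong) (use 1 in auto)
qed

text \<open>
  Since \<open>B\<close> is 2-increasing, the increment of \<open>markov B \<phi>\<close> is the integral of \<open>\<phi>\<close> against a nonnegative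
  weight of total mass \<open>s' - s\<close>. The Lipschitz estimate, the monotonicity and the 2-increasing
  property of star products are all read off from this weight.
\<close>

lemma markov_diff:
  assumes B: "copula B" and s: "0 \<le> s" "s \<le> s'" "s' \<le> 1" and \<phi>: "bdd_measurable \<phi>"
  obtains d where "bdd_measurable d" "AE t in unit_lborel. 0 \<le> d t"
    "(\<integral>t. d t \<partial>unit_lborel) = s' - s"
    "markov B \<phi> s' - markov B \<phi> s = (\<integral>t. d t * \<phi> t \<partial>unit_lborel)"
proof -
  have I: "s \<in> {0..1}" "s' \<in> {0..1}" using s by auto
  define f where "f t = B s' t - B s t" for t
  have lip: "2-lipschitz_on {0..1} f"
    using lipschitz_on_diff[OF copula_lipschitz[OF B I(2)] copula_lipschitz[OF B I(1)]]
    unfolding f_def by simp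
  have mono: "mono_on {0..1} f"
  proof (rule mono_onI)
    fix y v :: real assume "y \<in> {0..1}" "v \<in> {0..1}" "y \<le> v"
    then show "f y \<le> f v" using copula_rectangle[OF B I _ _ s(2), of y v] unfolding f_def by simp
  qed
  have eq: "AE t in unit_lborel. deriv01 f t = deriv01 (B s') t - deriv01 (B s) t"
    using AE_deriv01_lincomb[OF copula_lipschitz[OF B I(2)] copula_lipschitz[OF B I(1)], of f 1 "-1"]
    unfolding f_def by simp
  show thesis
  proof (rule that)
    show bdd: "bdd_measurable (deriv01 f)" using lip by (rule bdd_measurable_deriv01)
    show "AE t in unit_lborel. 0 \<le> deriv01 f t" using lip mono by (rule AE_deriv01_nonneg)
    show "(\<integral>t. deriv01 f t \<partial>unit_lborel) = s' - s"
      using integral_deriv01_unit[OF lip] I copula_margins[OF B] unfolding f_def by simp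
    have "markov B \<phi> s' - markov B \<phi> s =
      (\<integral>t. deriv01 (B s') t * \<phi> t - deriv01 (B s) t * \<phi> t \<partial>unit_lborel)"
      unfolding markov_def using markov_integrable B I \<phi> by simp
    also have "\<dots> = (\<integral>t. deriv01 f t * \<phi> t \<partial>unit_lborel)"
    proof (rule integral_cong_AE)
      show "(\<lambda>t. deriv01 (B s') t * \<phi> t - deriv01 (B s) t * \<phi> t) \<in> borel_measurable unit_lborel"
        using markov_integrable[OF B I(1) \<phi>] markov_integrable[OF B I(2) \<phi>] by auto
      show "(\<lambda>t. deriv01 f t * \<phi> t) \<in> borel_measurable unit_lborel"
        using bdd_measurable_mult[OF bdd \<phi>] by (rule bdd_measurable_borel)
      show "AE t in unit_lborel. deriv01 (B s') t * \<phi> t - deriv01 (B s) t * \<phi> t = deriv01 f t * \<phi> t"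
        using eq by eventually_elim (simp only: left_diff_distrib)
    qed
    finally show "markov B \<phi> s' - markov B \<phi> s = (\<integral>t. deriv01 f t * \<phi> t \<partial>unit_lborel)" .
  qed
qed

lemma markov_lipschitz:
  assumes B: "copula B" and \<phi>: "bdd_measurable \<phi>" "AE t in unit_lborel. \<bar>\<phi> t\<bar> \<le> K" and K: "0 \<le> K"
  shows "K-lipschitz_on {0..1} (markov B \<phi>)"
proof (rule lipschitz_on_leI)
  fix s s' :: real assume s: "s \<in> {0..1}" "s' \<in> {0..1}" "s \<le> s'"
  obtain d where d: "bdd_measurable d" "AE t in unit_lborel. 0 \<le> d t"
    "(\<integral>t. d t \<partial>unit_lborel) = s' - s"
    "markov B \<phi> s' - markov B \<phi> s = (\<integral>t. d t * \<phi> t \<partial>unit_lborel)"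
    by (rule markov_diff[OF B _ s(3) _ \<phi>(1)]) (use s in auto)
  have "\<bar>\<integral>t. d t * \<phi> t \<partial>unit_lborel\<bar> \<le> (\<integral>t. \<bar>d t * \<phi> t\<bar> \<partial>unit_lborel)"
    by (rule integral_abs_bound)
  also have "\<dots> \<le> (\<integral>t. K * d t \<partial>unit_lborel)"
  proof (rule integral_mono_AE)
    show "integrable unit_lborel (\<lambda>t. \<bar>d t * \<phi> t\<bar>)"
      using bdd_measurable_integrable[OF bdd_measurable_mult[OF d(1) \<phi>(1)]] by auto
    show "integrable unit_lborel (\<lambda>t. K * d t)"
      using bdd_measurable_integrable[OF d(1)] by auto
    show "AE t in unit_lborel. \<bar>d t * \<phi> t\<bar> \<le> K * d t"
      using d(2) \<phi>(2) by eventually_elim (simp add: abs_mult mult.commute[of K] mult_left_mono)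
  qed
  also have "\<dots> = K * (s' - s)" using d(3) by simp
  finally show "dist (markov B \<phi> s) (markov B \<phi> s') \<le> K * dist s s'"
    using d(4) s(3) by (simp add: dist_real_def abs_minus_commute)
qed (rule K)

lemma markov_lipschitz_ex:
  assumes B: "copula B" and \<phi>: "bdd_measurable \<phi>"
  shows "\<exists>K. K-lipschitz_on {0..1} (markov B \<phi>)"
proof -
  obtain K where "AE t in unit_lborel. \<bar>\<phi> t\<bar> \<le> K" using \<phi> unfolding bdd_measurable_def by blast
  then have "AE t in unit_lborel. \<bar>\<phi> t\<bar> \<le> max K 0" by eventually_elim simp
  from markov_lipschitz[OF B \<phi> this] show ?thesis by auto
qed

lemma deriv01_markov_nonneg:
  assumes B: "copula B" and \<phi>: "bdd_measurable \<phi>" and nn: "\<And>t. 0 \<le> \<phi> t"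
  shows "AE s in unit_lborel. 0 \<le> deriv01 (markov B \<phi>) s"
    and "(\<integral>s. deriv01 (markov B \<phi>) s \<partial>unit_lborel) = (\<integral>t. \<phi> t \<partial>unit_lborel)"
proof -
  obtain K where lip: "K-lipschitz_on {0..1} (markov B \<phi>)" using markov_lipschitz_ex[OF B \<phi>] by blast
  have "mono_on {0..1} (markov B \<phi>)"
  proof (rule mono_onI)
    fix s s' :: real assume s: "s \<in> {0..1}" "s' \<in> {0..1}" "s \<le> s'"
    obtain d where d: "bdd_measurable d" "AE t in unit_lborel. 0 \<le> d t"
      "(\<integral>t. d t \<partial>unit_lborel) = s' - s"
      "markov B \<phi> s' - markov B \<phi> s = (\<integral>t. d t * \<phi> t \<partial>unit_lborel)"
      by (rule markov_diff[OF B _ s(3) _ \<phi>(1)]) (use s in auto)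
    have "AE t in unit_lborel. 0 \<le> d t * \<phi> t"
      using d(2) by eventually_elim (simp add: nn)
    then have "0 \<le> (\<integral>t. d t * \<phi> t \<partial>unit_lborel)" by (rule integral_nonneg_AE)
    then show "markov B \<phi> s \<le> markov B \<phi> s'" using d(4) by simp
  qed
  with lip show "AE s in unit_lborel. 0 \<le> deriv01 (markov B \<phi>) s" by (rule AE_deriv01_nonneg)
  show "(\<integral>s. deriv01 (markov B \<phi>) s \<partial>unit_lborel) = (\<integral>t. \<phi> t \<partial>unit_lborel)"
    using integral_deriv01_unit[OF lip] markov_margins[OF B] by simp
qed

lemma AE_deriv01_markov_lincomb:
  assumes B: "copula B" and \<phi>: "bdd_measurable \<phi>" and \<psi>: "bdd_measurable \<psi>"
  shows "AE s in unit_lborel. deriv01 (markov B (\<lambda>t. a * \<phi> t + b * \<psi> t)) s =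
           a * deriv01 (markov B \<phi>) s + b * deriv01 (markov B \<psi>) s"
proof -
  obtain K where K: "K-lipschitz_on {0..1} (markov B \<phi>)" using markov_lipschitz_ex[OF B \<phi>] by blast
  obtain L where L: "L-lipschitz_on {0..1} (markov B \<psi>)" using markov_lipschitz_ex[OF B \<psi>] by blast
  show ?thesis
    by (rule AE_deriv01_lincomb[OF K L]) (rule markov_lincomb[OF B _ \<phi> \<psi>])
qed

lemma bdd_measurable_deriv01_markov:
  assumes "copula B" "bdd_measurable \<phi>"
  shows "bdd_measurable (deriv01 (markov B \<phi>))"
  using markov_lipschitz_ex[OF assms] bdd_measurable_deriv01 by blast

text \<open>
  The Markov operator preserves positivity and the integral, hence does not increase the
  \<open>L\<^sup>1\<close> norm: split \<open>\<phi>\<close> into its positive and its negative part.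
\<close>

lemma markov_contraction:
  assumes B: "copula B" and \<phi>: "bdd_measurable \<phi>"
  shows "(\<integral>s. \<bar>deriv01 (markov B \<phi>) s\<bar> \<partial>unit_lborel) \<le> (\<integral>t. \<bar>\<phi> t\<bar> \<partial>unit_lborel)"
proof -
  define p where "p t = (\<bar>\<phi> t\<bar> + \<phi> t) * (1/2)" for t
  define m where "m t = (\<bar>\<phi> t\<bar> - \<phi> t) * (1/2)" for t
  have p: "bdd_measurable p" unfolding p_def
    by (intro bdd_measurable_mult bdd_measurable_add bdd_measurable_abs \<phi> bdd_measurable_const)
  have m: "bdd_measurable m" unfolding m_def
    by (intro bdd_measurable_mult bdd_measurable_diff bdd_measurable_abs \<phi> bdd_measurable_const)
  have nn: "0 \<le> p t" "0 \<le> m t" for t unfolding p_def m_def by auto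
  have \<phi>_eq: "\<phi> = (\<lambda>t. 1 * p t + (-1) * m t)" unfolding p_def m_def by (auto simp: field_simps)
  note Dp = bdd_measurable_deriv01_markov[OF B p]
  note Dm = bdd_measurable_deriv01_markov[OF B m]
  have "(\<integral>s. \<bar>deriv01 (markov B \<phi>) s\<bar> \<partial>unit_lborel) \<le>
        (\<integral>s. deriv01 (markov B p) s + deriv01 (markov B m) s \<partial>unit_lborel)"
  proof (rule integral_mono_AE)
    show "integrable unit_lborel (\<lambda>s. \<bar>deriv01 (markov B \<phi>) s\<bar>)"
      by (intro bdd_measurable_integrable bdd_measurable_abs bdd_measurable_deriv01_markov B \<phi>)
    show "integrable unit_lborel (\<lambda>s. deriv01 (markov B p) s + deriv01 (markov B m) s)"
      by (intro bdd_measurable_integrable bdd_measurable_add Dp Dm)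
    have "AE s in unit_lborel. deriv01 (markov B \<phi>) s = deriv01 (markov B p) s - deriv01 (markov B m) s"
      using AE_deriv01_markov_lincomb[OF B p m, of 1 "-1"] unfolding \<phi>_eq[symmetric] by simp
    with deriv01_markov_nonneg(1)[OF B p nn(1)] deriv01_markov_nonneg(1)[OF B m nn(2)]
    show "AE s in unit_lborel. \<bar>deriv01 (markov B \<phi>) s\<bar> \<le> deriv01 (markov B p) s + deriv01 (markov B m) s"
      by eventually_elim simp
  qed
  also have "\<dots> = (\<integral>t. p t \<partial>unit_lborel) + (\<integral>t. m t \<partial>unit_lborel)"
    using deriv01_markov_nonneg(2)[OF B p nn(1)] deriv01_markov_nonneg(2)[OF B m nn(2)]
      bdd_measurable_integrable[OF Dp] bdd_measurable_integrable[OF Dm] by simp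
  also have "\<dots> = (\<integral>t. p t + m t \<partial>unit_lborel)"
    using bdd_measurable_integrable[OF p] bdd_measurable_integrable[OF m] by simp
  also have "(\<lambda>t. p t + m t) = (\<lambda>t. \<bar>\<phi> t\<bar>)" unfolding p_def m_def by (auto simp: field_simps)
  finally show ?thesis .
qed

lemma markov_indicator:
  assumes B: "copula B" and "s \<in> {0..1}" "y \<in> {0..1}"
  shows "markov B (indicator {0..y}) s = B s y"
  unfolding markov_def using integral_deriv01[OF copula_lipschitz[OF B assms(2)], of 0 y]
    assms copula_margins[OF B] by simp

text \<open>
  The operators of a copula and of its transpose are adjoint to each other; this is the analytic
  core of associativity. Both sides are linear in \<open>\<phi>\<close> and, by the contraction property, bounded by
  a multiple of the \<open>L\<^sup>1\<close> norm of \<open>\<phi>\<close>. For \<open>\<phi> = 1\<^bsub>[0,y]\<^esub>\<close> the left side is an integrated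
  derivative, while on the right \<open>markov B \<phi>\<close> is the section \<open>B(\<cdot>, y)\<close>; both are equal to
  \<open>\<integral> \<psi>(s) \<partial>\<^sub>1B(s, y) ds\<close>.
\<close>

lemma markov_duality:
  assumes B: "copula B" and \<psi>: "bdd_measurable \<psi>" and \<phi>: "bdd_measurable \<phi>"
  shows "(\<integral>t. deriv01 (markov (flip B) \<psi>) t * \<phi> t \<partial>unit_lborel) =
         (\<integral>s. \<psi> s * deriv01 (markov B \<phi>) s \<partial>unit_lborel)"
proof -
  let ?H = "markov (flip B) \<psi>"
  define E where "E \<phi> = (\<integral>t. deriv01 ?H t * \<phi> t \<partial>unit_lborel) -
         (\<integral>s. \<psi> s * deriv01 (markov B \<phi>) s \<partial>unit_lborel)" for \<phi>
  have H: "bdd_measurable (deriv01 ?H)"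
    by (intro bdd_measurable_deriv01_markov copula_flip B \<psi>)
  have int1: "integrable unit_lborel (\<lambda>t. deriv01 ?H t * \<phi> t)" if "bdd_measurable \<phi>" for \<phi>
    by (intro bdd_measurable_integrable bdd_measurable_mult H that)
  have int2: "integrable unit_lborel (\<lambda>s. \<psi> s * deriv01 (markov B \<phi>) s)" if "bdd_measurable \<phi>" for \<phi>
    by (intro bdd_measurable_integrable bdd_measurable_mult \<psi> bdd_measurable_deriv01_markov B that)
  have lincomb: "E (\<lambda>t. a * \<phi>1 t + b * \<phi>2 t) = a * E \<phi>1 + b * E \<phi>2"
    if "bdd_measurable \<phi>1" "bdd_measurable \<phi>2" for a b \<phi>1 \<phi>2
  proof -
    have sum: "bdd_measurable (\<lambda>t. a * \<phi>1 t + b * \<phi>2 t)"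
      by (intro bdd_measurable_add bdd_measurable_cmult that)
    have "(\<integral>t. deriv01 ?H t * (a * \<phi>1 t + b * \<phi>2 t) \<partial>unit_lborel) =
      (\<integral>t. a * (deriv01 ?H t * \<phi>1 t) + b * (deriv01 ?H t * \<phi>2 t) \<partial>unit_lborel)"
      by (intro Bochner_Integration.integral_cong) (auto simp: algebra_simps)
    also have "\<dots> = a * (\<integral>t. deriv01 ?H t * \<phi>1 t \<partial>unit_lborel) + b * (\<integral>t. deriv01 ?H t * \<phi>2 t \<partial>unit_lborel)"
      using int1 that by simp
    finally have 1: "(\<integral>t. deriv01 ?H t * (a * \<phi>1 t + b * \<phi>2 t) \<partial>unit_lborel) = \<dots>" .
    have "(\<integral>s. \<psi> s * deriv01 (markov B (\<lambda>t. a * \<phi>1 t + b * \<phi>2 t)) s \<partial>unit_lborel) =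
      (\<integral>s. a * (\<psi> s * deriv01 (markov B \<phi>1) s) + b * (\<psi> s * deriv01 (markov B \<phi>2) s) \<partial>unit_lborel)"
    proof (rule integral_cong_AE)
      show "(\<lambda>s. \<psi> s * deriv01 (markov B (\<lambda>t. a * \<phi>1 t + b * \<phi>2 t)) s) \<in> borel_measurable unit_lborel"
        using int2[OF sum] by auto
      show "(\<lambda>s. a * (\<psi> s * deriv01 (markov B \<phi>1) s) + b * (\<psi> s * deriv01 (markov B \<phi>2) s)) \<in> borel_measurable unit_lborel"
        using int2[OF that(1)] int2[OF that(2)] by auto
      show "AE s in unit_lborel. \<psi> s * deriv01 (markov B (\<lambda>t. a * \<phi>1 t + b * \<phi>2 t)) s =
         a * (\<psi> s * deriv01 (markov B \<phi>1) s) + b * (\<psi> s * deriv01 (markov B \<phi>2) s)"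
        using AE_deriv01_markov_lincomb[OF B that, of a b]
        by eventually_elim (simp add: algebra_simps)
    qed
    also have "\<dots> = a * (\<integral>s. \<psi> s * deriv01 (markov B \<phi>1) s \<partial>unit_lborel) +
        b * (\<integral>s. \<psi> s * deriv01 (markov B \<phi>2) s \<partial>unit_lborel)"
      using int2 that by simp
    finally show ?thesis unfolding E_def 1 by (simp add: algebra_simps)
  qed
  obtain K L where KL: "AE t in unit_lborel. \<bar>deriv01 ?H t\<bar> \<le> K" "AE t in unit_lborel. \<bar>\<psi> t\<bar> \<le> L"
    using H \<psi> unfolding bdd_measurable_def by blast
  \<comment> \<open>One nonnegative constant that bounds both fixed factors almost everywhere.\<close>
  define N where "N = max 0 (max K L)"
  have N: "0 \<le> N" unfolding N_def by simp
  have HN: "AE t in unit_lborel. \<bar>deriv01 ?H t\<bar> \<le> N"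
    using KL(1) by eventually_elim (simp add: N_def)
  have \<psi>N: "AE t in unit_lborel. \<bar>\<psi> t\<bar> \<le> N"
    using KL(2) by eventually_elim (simp add: N_def)
  have mult_bound: "\<bar>\<integral>t. u t * v t \<partial>unit_lborel\<bar> \<le> N * (\<integral>t. \<bar>v t\<bar> \<partial>unit_lborel)"
    if u: "bdd_measurable u" "AE t in unit_lborel. \<bar>u t\<bar> \<le> N" and v: "bdd_measurable v" for u v
  proof -
    have "\<bar>\<integral>t. u t * v t \<partial>unit_lborel\<bar> \<le> (\<integral>t. \<bar>u t * v t\<bar> \<partial>unit_lborel)"
      by (rule integral_abs_bound)
    also have "\<dots> \<le> (\<integral>t. N * \<bar>v t\<bar> \<partial>unit_lborel)"
    proof (rule integral_mono_AE)
      show "integrable unit_lborel (\<lambda>t. \<bar>u t * v t\<bar>)"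
        by (intro bdd_measurable_integrable bdd_measurable_abs bdd_measurable_mult u v)
      show "integrable unit_lborel (\<lambda>t. N * \<bar>v t\<bar>)"
        by (intro bdd_measurable_integrable bdd_measurable_abs bdd_measurable_cmult v)
      show "AE t in unit_lborel. \<bar>u t * v t\<bar> \<le> N * \<bar>v t\<bar>"
        using u(2) by eventually_elim (simp add: abs_mult mult_right_mono)
    qed
    finally show ?thesis by simp
  qed
  have "E \<phi> = 0"
  proof (rule L1_bounded_functional_eq_0[of E "2 * N", OF _ _ _ _ \<phi>])
    show "E (\<lambda>t. \<phi>1 t + \<phi>2 t) = E \<phi>1 + E \<phi>2" if "bdd_measurable \<phi>1" "bdd_measurable \<phi>2" for \<phi>1 \<phi>2
      using lincomb[OF that, of 1 1] by simp
    show "E (\<lambda>t. c * \<phi> t) = c * E \<phi>" if "bdd_measurable \<phi>" for c \<phi>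
      using lincomb[OF that that, of c 0] by simp
    show "\<bar>E \<phi>\<bar> \<le> 2 * N * (\<integral>t. \<bar>\<phi> t\<bar> \<partial>unit_lborel)" if \<phi>: "bdd_measurable \<phi>" for \<phi>
    proof -
      have "\<bar>E \<phi>\<bar> \<le> N * (\<integral>t. \<bar>\<phi> t\<bar> \<partial>unit_lborel) + N * (\<integral>s. \<bar>deriv01 (markov B \<phi>) s\<bar> \<partial>unit_lborel)"
        unfolding E_def using mult_bound[OF H HN \<phi>]
          mult_bound[OF \<psi> \<psi>N bdd_measurable_deriv01_markov[OF B \<phi>]] by linarith
      also have "\<dots> \<le> N * (\<integral>t. \<bar>\<phi> t\<bar> \<partial>unit_lborel) + N * (\<integral>t. \<bar>\<phi> t\<bar> \<partial>unit_lborel)"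
        using markov_contraction[OF B \<phi>] N by (intro add_left_mono mult_left_mono)
      finally show ?thesis by simp
    qed
    fix y :: real assume y: "y \<in> {0..1}"
    obtain M where lip: "M-lipschitz_on {0..1} ?H"
      using markov_lipschitz_ex[OF copula_flip[OF B] \<psi>] by blast
    have "(\<integral>t. deriv01 ?H t * indicator {0..y} t \<partial>unit_lborel) = ?H y"
      using integral_deriv01[OF lip, of 0 y] y markov_margins(1)[OF copula_flip[OF B]] by simp
    also have "\<dots> = (\<integral>s. \<psi> s * deriv01 (markov B (indicator {0..y})) s \<partial>unit_lborel)"
      unfolding markov_def[of "flip B"]
    proof (rule Bochner_Integration.integral_cong)
      fix s assume "s \<in> space unit_lborel"
      then have s: "s \<in> {0..1}" by simp
      have "deriv01 (flip B y) s = deriv01 (markov B (indicator {0..y})) s"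
        by (rule deriv01_cong[OF _ s]) (use markov_indicator[OF B _ y] in \<open>simp add: flip_def\<close>)
      then show "deriv01 (flip B y) s * \<psi> s = \<psi> s * deriv01 (markov B (indicator {0..y})) s" by simp
    qed simp
    finally show "E (indicator {0..y}) = 0" unfolding E_def by simp
  qed
  then show ?thesis unfolding E_def by simp
qed

section \<open>Copulas form a monoid\<close>

text \<open>
  With \<open>\<psi> = \<partial>\<^sub>2A(x, \<cdot>)\<close> and \<open>\<phi> = \<partial>\<^sub>1C(\<cdot>, y)\<close>, the two bracketings are the two sides of the duality.
\<close>

lemma star_assoc_copula:
  assumes A: "copula A" and B: "copula B" and C: "copula C"
  shows "(A \<star> B) \<star> C = A \<star> (B \<star> C)"
proof (intro ext)
  fix x y
  show "((A \<star> B) \<star> C) x y = (A \<star> (B \<star> C)) x y"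
  proof (cases "x \<in> {0..1} \<and> y \<in> {0..1}")
    case True
    then have x: "x \<in> {0..1}" and y: "y \<in> {0..1}" by auto
    define \<psi> where "\<psi> = deriv01 (A x)"
    define \<phi> where "\<phi> = deriv01 (\<lambda>s. C s y)"
    have \<psi>: "bdd_measurable \<psi>" unfolding \<psi>_def by (rule bdd_measurable_copula_section[OF A x])
    have \<phi>: "bdd_measurable \<phi>" unfolding \<phi>_def by (rule bdd_measurable_copula_section[OF C y])
    have "((A \<star> B) \<star> C) x y = (\<integral>t. deriv01 (markov (flip B) \<psi>) t * \<phi> t \<partial>unit_lborel)"
      unfolding star_prod_eq[OF x y, of "A \<star> B"] \<phi>_def
    proof (rule Bochner_Integration.integral_cong)
      fix t assume "t \<in> space unit_lborel"
      then have t: "t \<in> {0..1}" by simp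
      have "deriv01 ((A \<star> B) x) t = deriv01 (markov (flip B) \<psi>) t"
        by (rule deriv01_cong[OF _ t])
           (use x in \<open>simp add: star_prod_eq markov_def flip_def \<psi>_def mult.commute\<close>)
      then show "deriv01 ((A \<star> B) x) t * deriv01 (\<lambda>s. C s y) t =
        deriv01 (markov (flip B) \<psi>) t * deriv01 (\<lambda>s. C s y) t" by simp
    qed simp
    also have "\<dots> = (\<integral>s. \<psi> s * deriv01 (markov B \<phi>) s \<partial>unit_lborel)"
      by (rule markov_duality[OF B \<psi> \<phi>])
    also have "\<dots> = (A \<star> (B \<star> C)) x y"
      unfolding star_prod_eq[OF x y, of A] \<psi>_def
    proof (rule Bochner_Integration.integral_cong)
      fix s assume "s \<in> space unit_lborel"
      then have s: "s \<in> {0..1}" by simp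
      have "deriv01 (markov B \<phi>) s = deriv01 (\<lambda>s. (B \<star> C) s y) s"
        by (rule deriv01_cong[OF _ s]) (use y in \<open>simp add: star_prod_eq markov_def \<phi>_def\<close>)
      then show "deriv01 (A x) s * deriv01 (markov B \<phi>) s =
        deriv01 (A x) s * deriv01 (\<lambda>s. (B \<star> C) s y) s" by simp
    qed simp
    finally show ?thesis .
  qed (simp add: star_prod_zero)
qed

lemma copulaI:
  assumes zero: "\<And>x y. \<not> (x \<in> {0..1} \<and> y \<in> {0..1}) \<Longrightarrow> C x y = 0"
    and margins: "\<And>t. t \<in> {0..1} \<Longrightarrow> C t 0 = 0 \<and> C t 1 = t \<and> C 0 t = 0 \<and> C 1 t = t"
    and rect: "\<And>x u y v. x \<in> {0..1} \<Longrightarrow> u \<in> {0..1} \<Longrightarrow> y \<in> {0..1} \<Longrightarrow> v \<in> {0..1} \<Longrightarrow>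
        x \<le> u \<Longrightarrow> y \<le> v \<Longrightarrow> 0 \<le> C u v - C u y - C x v + C x y"
  shows "copula C"
proof -
  have "C x y \<in> {0..1}" if x: "x \<in> {0..1}" and y: "y \<in> {0..1}" for x y
    using rect[of 0 x 0 y] rect[of x 1 0 y] margins[OF x] margins[OF y] margins[of 0] margins[of 1] x y
    by simp
  then show ?thesis unfolding copula_def using assms by simp
qed

text \<open>
  The second difference of \<open>A \<star> B\<close> over a rectangle is the increment, in the first variable, of
  \<open>markov A \<psi>\<close>, where \<open>\<psi>\<close> is the difference of the derivatives of two sections of \<open>B\<close>. Since
  \<open>B\<close> is 2-increasing, \<open>\<psi>\<close> is nonnegative almost everywhere. The margins in the second variable
  follow by transposition.
\<close>

lemma copula_star:
  assumes A: "copula A" and B: "copula B"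
  shows "copula (A \<star> B)"
proof (rule copulaI)
  show "(A \<star> B) x y = 0" if "\<not> (x \<in> {0..1} \<and> y \<in> {0..1})" for x y
    using that by (rule star_prod_zero)
  have margins: "(A \<star> B) t 0 = 0" "(A \<star> B) t 1 = t"
    if A: "copula A" and B: "copula B" and t: "t \<in> {0..1}" for A B t
  proof -
    have eq: "(A \<star> B) t y = markov (flip B) (deriv01 (A t)) y" if "y \<in> {0..1}" for y
      using star_prod_eq[OF t that, of A B] by (simp add: markov_def flip_def mult.commute)
    show "(A \<star> B) t 0 = 0"
      using eq[of 0] markov_margins(1)[OF copula_flip[OF B]] by simp
    show "(A \<star> B) t 1 = t"
      using eq[of 1] markov_margins(2)[OF copula_flip[OF B]]
        integral_deriv01_unit[OF copula_lipschitz[OF A t]] copula_margins[OF A t] by simp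
  qed
  show "(A \<star> B) t 0 = 0 \<and> (A \<star> B) t 1 = t \<and> (A \<star> B) 0 t = 0 \<and> (A \<star> B) 1 t = t" if t: "t \<in> {0..1}" for t
    using margins[OF A B t] margins[OF copula_flip[OF B] copula_flip[OF A] t]
    unfolding flip_star[symmetric] by (simp add: flip_def)
next
  fix x u y v :: real
  assume xu: "x \<in> {0..1}" "u \<in> {0..1}" "x \<le> u" and yv: "y \<in> {0..1}" "v \<in> {0..1}" "y \<le> v"
  define \<psi> where "\<psi> t = deriv01 (\<lambda>s. B s v) t - deriv01 (\<lambda>s. B s y) t" for t
  have \<psi>: "bdd_measurable \<psi>"
    unfolding \<psi>_def by (intro bdd_measurable_diff bdd_measurable_copula_section B yv)
  have eq: "(A \<star> B) w v - (A \<star> B) w y = markov A \<psi> w" if w: "w \<in> {0..1}" for w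
  proof -
    have "markov A \<psi> w = markov A (deriv01 (\<lambda>s. B s v)) w - markov A (deriv01 (\<lambda>s. B s y)) w"
      using markov_lincomb[OF A w bdd_measurable_copula_section(2)[OF B yv(2)]
          bdd_measurable_copula_section(2)[OF B yv(1)], of 1 "-1"]
      unfolding \<psi>_def by simp
    then show ?thesis using star_prod_eq[OF w] yv by (simp add: markov_def)
  qed
  have nonneg: "AE t in unit_lborel. 0 \<le> \<psi> t"
  proof -
    have lip: "2-lipschitz_on {0..1} (\<lambda>s. B s v - B s y)"
      using lipschitz_on_diff[OF copula_lipschitz_flip[OF B yv(2)] copula_lipschitz_flip[OF B yv(1)]] by simp
    have mono: "mono_on {0..1} (\<lambda>s. B s v - B s y)"
    proof (rule mono_onI)
      fix s s' :: real assume "s \<in> {0..1}" "s' \<in> {0..1}" "s \<le> s'"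
      then show "B s v - B s y \<le> B s' v - B s' y"
        using copula_rectangle[OF B, of s s' y v] yv by simp
    qed
    have "AE t in unit_lborel. deriv01 (\<lambda>s. B s v - B s y) t = \<psi> t"
      using AE_deriv01_lincomb[OF copula_lipschitz_flip[OF B yv(2)] copula_lipschitz_flip[OF B yv(1)],
          of "\<lambda>s. B s v - B s y" 1 "-1"] unfolding \<psi>_def by simp
    with AE_deriv01_nonneg[OF lip mono] show ?thesis by eventually_elim simp
  qed
  obtain d where d: "AE t in unit_lborel. 0 \<le> d t"
    "markov A \<psi> u - markov A \<psi> x = (\<integral>t. d t * \<psi> t \<partial>unit_lborel)"
    by (rule markov_diff[OF A _ xu(3) _ \<psi>]) (use xu in auto)
  have "AE t in unit_lborel. 0 \<le> d t * \<psi> t"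
    using d(1) nonneg by eventually_elim simp
  then have "0 \<le> (\<integral>t. d t * \<psi> t \<partial>unit_lborel)" by (rule integral_nonneg_AE)
  then show "0 \<le> (A \<star> B) u v - (A \<star> B) u y - (A \<star> B) x v + (A \<star> B) x y"
    using d(2) eq[OF xu(1)] eq[OF xu(2)] by simp
qed

lemma copula_M: "copula M_copula"
  by (rule copulaI) (auto simp: M_copula_def min_def)

text \<open>
  \<open>\<partial>\<^sub>2M(x, \<cdot>)\<close> is the indicator function of \<open>[0,x]\<close>, except at \<open>x\<close>, so the product integrates
  \<open>\<partial>\<^sub>1A(\<cdot>, y)\<close> over \<open>[0,x]\<close>.
\<close>

lemma M_star:
  assumes A: "copula A"
  shows "M_copula \<star> A = A"
proof (intro ext)
  fix x y
  show "(M_copula \<star> A) x y = A x y"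
  proof (cases "x \<in> {0..1} \<and> y \<in> {0..1}")
    case True
    then have x: "x \<in> {0..1}" and y: "y \<in> {0..1}" by auto
    have "AE t in lborel. t \<noteq> x" by (rule AE_lborel_singleton)
    then have eq: "AE t in unit_lborel. deriv01 (M_copula x) t = indicator {0..x} t"
      unfolding AE_unit_lborel
    proof eventually_elim
      case (elim t)
      show ?case
      proof
        assume t: "t \<in> {0..1}"
        have M: "deriv01 (M_copula x) t = deriv01 (min x) t"
          by (rule deriv01_cong[OF _ t]) (use x in \<open>simp add: M_copula_def\<close>)
        show "deriv01 (M_copula x) t = indicator {0..x} t"
        proof (cases "t < x")
          case True
          have "((\<lambda>s. s) has_real_derivative 1) (at t within {0..1})" by simp
          then have "(min x has_real_derivative 1) (at t within {0..1})"
            by (rule has_field_derivative_transform_within[where d = "x - t"])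
               (use True t in \<open>auto simp: dist_real_def\<close>)
          then show ?thesis using M deriv01_eqI[OF _ t] True t by (auto simp: indicator_def)
        next
          case False
          with elim have "x < t" by simp
          have "((\<lambda>s. x) has_real_derivative 0) (at t within {0..1})" by simp
          then have "(min x has_real_derivative 0) (at t within {0..1})"
            by (rule has_field_derivative_transform_within[where d = "t - x"])
               (use \<open>x < t\<close> t in \<open>auto simp: dist_real_def\<close>)
          then show ?thesis using M deriv01_eqI[OF _ t] \<open>x < t\<close> t by (auto simp: indicator_def)
        qed
      qed
    qed
    have "(M_copula \<star> A) x y = (\<integral>t. deriv01 (\<lambda>s. A s y) t * indicator {0..x} t \<partial>unit_lborel)"
      unfolding star_prod_eq[OF x y]
    proof (rule integral_cong_AE)
      show "(\<lambda>t. deriv01 (M_copula x) t * deriv01 (\<lambda>s. A s y) t) \<in> borel_measurable unit_lborel"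
        by (intro bdd_measurable_borel bdd_measurable_mult bdd_measurable_copula_section copula_M A x y)
      show "(\<lambda>t. deriv01 (\<lambda>s. A s y) t * indicator {0..x} t) \<in> borel_measurable unit_lborel"
        by (intro bdd_measurable_borel bdd_measurable_mult bdd_measurable_copula_section
            bdd_measurable_indicator_borel A y) simp
      show "AE t in unit_lborel. deriv01 (M_copula x) t * deriv01 (\<lambda>s. A s y) t =
          deriv01 (\<lambda>s. A s y) t * indicator {0..x} t"
        using eq by eventually_elim simp
    qed
    also have "\<dots> = A x y"
      using integral_deriv01[OF copula_lipschitz_flip[OF A y], of 0 x] x copula_margins(3)[OF A y] by simp
    finally show ?thesis .
  next
    case False
    then show ?thesis using copula_zero[OF A] star_prod_zero by simp
  qed
qed

lemma star_M:
  assumes A: "copula A"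
  shows "A \<star> M_copula = A"
proof -
  have "flip M_copula = M_copula" by (auto simp: flip_def M_copula_def fun_eq_iff min.commute)
  then have "flip (A \<star> M_copula) = flip A"
    using M_star[OF copula_flip[OF A]] by (simp add: flip_star)
  then show ?thesis using flip_flip by metis
qed

section \<open>The algebra spanned by the copulas\<close>

text \<open>
  Differences, sums and multiples are all linear combinations of two functions, so that one
  computation covers the whole of bilinearity.
\<close>

definition lincomb ::
  "real \<Rightarrow> (real \<Rightarrow> real \<Rightarrow> real) \<Rightarrow> real \<Rightarrow> (real \<Rightarrow> real \<Rightarrow> real) \<Rightarrow> real \<Rightarrow> real \<Rightarrow> real" where
  "lincomb a A b B = (\<lambda>x y. a * A x y + b * B x y)"

lemma lincomb_eq: "lincomb a A b B = fun_scale a A + fun_scale b B"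
  by (simp add: lincomb_def fun_scale_def fun_eq_iff)

lemma copula_in_span: "copula C \<Longrightarrow> C \<in> span_copulas"
  unfolding span_copulas_def by (rule fun_space.span_base) simp

lemma lincomb_in_span: "A \<in> span_copulas \<Longrightarrow> B \<in> span_copulas \<Longrightarrow> lincomb a A b B \<in> span_copulas"
  unfolding lincomb_eq span_copulas_def by (intro fun_space.span_add fun_space.span_scale)

lemma span_copulas_induct [consumes 1, case_names copula lincomb]:
  assumes "A \<in> span_copulas"
    and base: "\<And>C. copula C \<Longrightarrow> P C"
    and step: "\<And>a A b B. A \<in> span_copulas \<Longrightarrow> B \<in> span_copulas \<Longrightarrow> P A \<Longrightarrow> P B \<Longrightarrow> P (lincomb a A b B)"
  shows "P A"
proof -
  have "A \<in> span_copulas \<and> P A"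
    using assms(1) unfolding span_copulas_def
  proof (induction rule: fun_space.span_induct_alt)
    case base
    \<comment> \<open>Any copula would do here; it only has to be known that one exists.\<close>
    have "lincomb 0 M_copula 0 M_copula = 0" by (simp add: lincomb_def fun_eq_iff)
    moreover have "P (lincomb 0 M_copula 0 M_copula)"
      by (intro assms(2,3) copula_in_span copula_M)
    ultimately have "P 0" by (simp only:)
    moreover have "0 \<in> fun_space.span {C. copula C}" by (rule fun_space.span_zero)
    ultimately show ?case by blast
  next
    case (step c C B)
    have "lincomb c C 1 B = fun_scale c C + B" by (simp add: lincomb_def fun_scale_def fun_eq_iff)
    moreover have "lincomb c C 1 B \<in> span_copulas \<and> P (lincomb c C 1 B)"
      using step assms(2,3) lincomb_in_span copula_in_span unfolding span_copulas_def by blast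
    ultimately show ?case unfolding span_copulas_def by (simp only:)
  qed
  then show ?thesis ..
qed

lemma span_section_lipschitz:
  assumes "A \<in> span_copulas" "x \<in> {0..1}"
  shows "\<exists>L. L-lipschitz_on {0..1} (A x)"
  using assms(1)
proof (induction rule: span_copulas_induct)
  case (copula C)
  then show ?case using copula_lipschitz[OF _ assms(2)] by blast
next
  case (lincomb a A b B)
  then obtain L M where "L-lipschitz_on {0..1} (A x)" "M-lipschitz_on {0..1} (B x)" by blast
  then have "(\<bar>a\<bar> * L + \<bar>b\<bar> * M)-lipschitz_on {0..1} (\<lambda>y. a * A x y + b * B x y)"
    by (intro lipschitz_on_add lipschitz_on_cmult_real)
  then show ?case unfolding lincomb_def by blast
qed

lemma flip_lincomb: "flip (lincomb a A b B) = lincomb a (flip A) b (flip B)"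
  by (simp add: flip_def lincomb_def)

lemma flip_in_span: "A \<in> span_copulas \<Longrightarrow> flip A \<in> span_copulas"
proof (induction rule: span_copulas_induct)
  case (copula C)
  then show ?case by (intro copula_in_span copula_flip)
next
  case (lincomb a A b B)
  then show ?case by (simp add: flip_lincomb lincomb_in_span)
qed

lemma star_lincomb_left:
  assumes A: "A \<in> span_copulas" and B: "B \<in> span_copulas" and C: "C \<in> span_copulas"
  shows "lincomb a A b B \<star> C = lincomb a (A \<star> C) b (B \<star> C)"
proof (intro ext)
  fix x y
  show "(lincomb a A b B \<star> C) x y = lincomb a (A \<star> C) b (B \<star> C) x y"
  proof (cases "x \<in> {0..1} \<and> y \<in> {0..1}")
    case True
    then have x: "x \<in> {0..1}" and y: "y \<in> {0..1}" by auto
    obtain K where K: "K-lipschitz_on {0..1} (A x)" using span_section_lipschitz[OF A x] by blast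
    obtain L where L: "L-lipschitz_on {0..1} (B x)" using span_section_lipschitz[OF B x] by blast
    obtain M where "M-lipschitz_on {0..1} (flip C y)"
      using span_section_lipschitz[OF flip_in_span[OF C] y] by blast
    then have c: "bdd_measurable (deriv01 (\<lambda>s. C s y))"
      unfolding flip_def by (rule bdd_measurable_deriv01)
    obtain N where N: "N-lipschitz_on {0..1} (lincomb a A b B x)"
      using span_section_lipschitz[OF lincomb_in_span[OF A B] x] by blast
    have int: "integrable unit_lborel (\<lambda>t. deriv01 (A x) t * deriv01 (\<lambda>s. C s y) t)"
      "integrable unit_lborel (\<lambda>t. deriv01 (B x) t * deriv01 (\<lambda>s. C s y) t)"
      using bdd_measurable_deriv01[OF K] bdd_measurable_deriv01[OF L] c
      by (auto intro!: bdd_measurable_integrable bdd_measurable_mult)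
    have "(lincomb a A b B \<star> C) x y = (\<integral>t. a * (deriv01 (A x) t * deriv01 (\<lambda>s. C s y) t) +
        b * (deriv01 (B x) t * deriv01 (\<lambda>s. C s y) t) \<partial>unit_lborel)"
      unfolding star_prod_eq[OF x y]
    proof (rule integral_cong_AE)
      show "(\<lambda>t. deriv01 (lincomb a A b B x) t * deriv01 (\<lambda>s. C s y) t) \<in> borel_measurable unit_lborel"
        by (intro bdd_measurable_borel bdd_measurable_mult c bdd_measurable_deriv01[OF N])
      show "(\<lambda>t. a * (deriv01 (A x) t * deriv01 (\<lambda>s. C s y) t) +
        b * (deriv01 (B x) t * deriv01 (\<lambda>s. C s y) t)) \<in> borel_measurable unit_lborel"
        using int by auto
      have "AE t in unit_lborel. deriv01 (lincomb a A b B x) t = a * deriv01 (A x) t + b * deriv01 (B x) t"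
        by (rule AE_deriv01_lincomb[OF K L]) (simp add: lincomb_def)
      then show "AE t in unit_lborel. deriv01 (lincomb a A b B x) t * deriv01 (\<lambda>s. C s y) t =
        a * (deriv01 (A x) t * deriv01 (\<lambda>s. C s y) t) + b * (deriv01 (B x) t * deriv01 (\<lambda>s. C s y) t)"
        by eventually_elim (simp add: algebra_simps)
    qed
    also have "\<dots> = lincomb a (A \<star> C) b (B \<star> C) x y"
      using int unfolding lincomb_def star_prod_eq[OF x y] by simp
    finally show ?thesis .
  next
    case False
    then show ?thesis by (simp add: lincomb_def star_prod_zero)
  qed
qed

lemma star_lincomb_right:
  assumes "A \<in> span_copulas" "B \<in> span_copulas" "C \<in> span_copulas"
  shows "C \<star> lincomb a A b B = lincomb a (C \<star> A) b (C \<star> B)"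
proof -
  have "flip (C \<star> lincomb a A b B) = flip (lincomb a (C \<star> A) b (C \<star> B))"
    using star_lincomb_left[of "flip A" "flip B" "flip C"] assms
    by (simp add: flip_star flip_lincomb flip_in_span)
  then show ?thesis using flip_flip by metis
qed

lemma star_in_span:
  assumes "A \<in> span_copulas" "B \<in> span_copulas"
  shows "A \<star> B \<in> span_copulas"
  using assms(1)
proof (induction rule: span_copulas_induct)
  case (copula A)
  note A = copula
  from assms(2) show ?case
  proof (induction rule: span_copulas_induct)
    case (copula B)
    with A show ?case by (intro copula_in_span copula_star)
  next
    case (lincomb a B b C)
    then show ?case by (simp add: star_lincomb_right lincomb_in_span copula_in_span A)
  qed
next
  case (lincomb a A b C)
  then show ?case by (simp add: star_lincomb_left lincomb_in_span assms(2))
qed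

text \<open>
  Both sides are linear in each factor, so the identity for copulas carries over to the span.
\<close>

theorem star_assoc:
  assumes A: "A \<in> span_copulas" and B: "B \<in> span_copulas" and C: "C \<in> span_copulas"
  shows "(A \<star> B) \<star> C = A \<star> (B \<star> C)"
  using A
proof (induction rule: span_copulas_induct)
  case cA: (copula A)
  then have A: "A \<in> span_copulas" by (rule copula_in_span)
  from B show ?case
  proof (induction rule: span_copulas_induct)
    case cB: (copula B)
    then have B: "B \<in> span_copulas" by (rule copula_in_span)
    from C show ?case
    proof (induction rule: span_copulas_induct)
      case (copula C)
      with cA cB show ?case by (rule star_assoc_copula)
    next
      case (lincomb a C b D)
      then show ?case by (simp add: star_lincomb_right star_in_span A B)
    qed
  next
    case (lincomb a B b D)
    then show ?case by (simp add: star_lincomb_right star_lincomb_left star_in_span A C)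
  qed
next
  case (lincomb a A b D)
  then show ?case by (simp add: star_lincomb_left star_in_span B C)
qed

section \<open>Invertible copulas and the star norm\<close>

lemma Inv_in_span: "U \<in> Inv_copulas \<Longrightarrow> U \<in> span_copulas"
  by (simp add: Inv_copulas_def copula_in_span)

lemma Inv_star:
  assumes "U \<in> Inv_copulas" "V \<in> Inv_copulas"
  shows "U \<star> V \<in> Inv_copulas"
proof -
  obtain D where D: "copula D" "U \<star> D = M_copula" "D \<star> U = M_copula"
    using assms(1) unfolding Inv_copulas_def by blast
  obtain E where E: "copula E" "V \<star> E = M_copula" "E \<star> V = M_copula"
    using assms(2) unfolding Inv_copulas_def by blast
  have UV: "copula U" "copula V" using assms unfolding Inv_copulas_def by auto
  have "(U \<star> V) \<star> (E \<star> D) = U \<star> ((V \<star> E) \<star> D)"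
    using UV D(1) E(1) by (simp add: star_assoc_copula copula_star)
  then have 1: "(U \<star> V) \<star> (E \<star> D) = M_copula" using D E by (simp add: M_star)
  have "(E \<star> D) \<star> (U \<star> V) = E \<star> ((D \<star> U) \<star> V)"
    using UV D(1) E(1) by (simp add: star_assoc_copula copula_star)
  then have 2: "(E \<star> D) \<star> (U \<star> V) = M_copula" using D E UV by (simp add: M_star)
  show ?thesis unfolding Inv_copulas_def
    using 1 2 copula_star[OF UV] copula_star[OF E(1) D(1)] by blast
qed

lemma Inv_inverse:
  assumes "U \<in> Inv_copulas"
  obtains D where "D \<in> Inv_copulas" "U \<star> D = M_copula" "D \<star> U = M_copula"
  using assms unfolding Inv_copulas_def by blast

text \<open>
  In a group, translations are bijections; this is where invertibility enters.
\<close>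

lemma Inv_translate:
  assumes U: "U \<in> Inv_copulas"
  shows "(\<lambda>V. V \<star> U) ` Inv_copulas = Inv_copulas" "(\<lambda>V. U \<star> V) ` Inv_copulas = Inv_copulas"
proof -
  obtain D where D: "D \<in> Inv_copulas" "U \<star> D = M_copula" "D \<star> U = M_copula"
    by (rule Inv_inverse[OF U])
  have cop: "copula V" if "V \<in> Inv_copulas" for V using that by (simp add: Inv_copulas_def)
  have cancel: "(V \<star> D) \<star> U = V" "U \<star> (D \<star> V) = V" if "V \<in> Inv_copulas" for V
  proof -
    have "(V \<star> D) \<star> U = V \<star> (D \<star> U)" using that U D(1) by (intro star_assoc_copula cop)
    then show "(V \<star> D) \<star> U = V" using star_M[OF cop[OF that]] D(3) by simp
    have "(U \<star> D) \<star> V = U \<star> (D \<star> V)" using that U D(1) by (intro star_assoc_copula cop)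
    then show "U \<star> (D \<star> V) = V" using M_star[OF cop[OF that]] D(2) by simp
  qed
  show "(\<lambda>V. V \<star> U) ` Inv_copulas = Inv_copulas"
  proof (intro equalityI subsetI)
    fix V assume V: "V \<in> Inv_copulas"
    show "V \<in> (\<lambda>V. V \<star> U) ` Inv_copulas"
      using cancel(1)[OF V] Inv_star[OF V D(1)] by (intro image_eqI[where x = "V \<star> D"]) simp_all
  qed (use Inv_star[OF _ U] in blast)
  show "(\<lambda>V. U \<star> V) ` Inv_copulas = Inv_copulas"
  proof (intro equalityI subsetI)
    fix V assume V: "V \<in> Inv_copulas"
    show "V \<in> (\<lambda>V. U \<star> V) ` Inv_copulas"
      using cancel(2)[OF V] Inv_star[OF D(1) V] by (intro image_eqI[where x = "D \<star> V"]) simp_all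
  qed (use Inv_star[OF U] in blast)
qed

text \<open>
  Since \<open>V \<star> (U \<star> A) \<star> W = (V \<star> U) \<star> A \<star> W\<close>, the two suprema run over the same set of
  numbers: the translation \<open>V \<mapsto> V \<star> U\<close> only permutes the index set.
\<close>

lemma star_norm_left:
  assumes A: "A \<in> span_copulas" and U: "U \<in> Inv_copulas"
  shows "star_norm (U \<star> A) = star_norm A"
proof -
  have "star_norm (U \<star> A) = (SUP p\<in>Inv_copulas \<times> Inv_copulas.
      (\<lambda>(V, W). sobolev_norm (V \<star> A \<star> W)) (map_prod (\<lambda>V. V \<star> U) id p))"
    unfolding star_norm_def
    by (rule SUP_cong) (use A U in \<open>auto simp: star_assoc star_in_span Inv_in_span\<close>)
  also have "\<dots> = (SUP p\<in>map_prod (\<lambda>V. V \<star> U) id ` (Inv_copulas \<times> Inv_copulas).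
      (\<lambda>(V, W). sobolev_norm (V \<star> A \<star> W)) p)"
    by (simp only: image_image)
  also have "map_prod (\<lambda>V. V \<star> U) id ` (Inv_copulas \<times> Inv_copulas) = Inv_copulas \<times> Inv_copulas"
    using Inv_translate(1)[OF U] by (simp add: map_prod_surj_on)
  finally show ?thesis unfolding star_norm_def .
qed

lemma star_norm_right:
  assumes A: "A \<in> span_copulas" and U: "U \<in> Inv_copulas"
  shows "star_norm (A \<star> U) = star_norm A"
proof -
  have "star_norm (A \<star> U) = (SUP p\<in>Inv_copulas \<times> Inv_copulas.
      (\<lambda>(V, W). sobolev_norm (V \<star> A \<star> W)) (map_prod id (\<lambda>W. U \<star> W) p))"
    unfolding star_norm_def
    by (rule SUP_cong) (use A U in \<open>auto simp: star_assoc star_in_span Inv_in_span\<close>)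
  also have "\<dots> = (SUP p\<in>map_prod id (\<lambda>W. U \<star> W) ` (Inv_copulas \<times> Inv_copulas).
      (\<lambda>(V, W). sobolev_norm (V \<star> A \<star> W)) p)"
    by (simp only: image_image)
  also have "map_prod id (\<lambda>W. U \<star> W) ` (Inv_copulas \<times> Inv_copulas) = Inv_copulas \<times> Inv_copulas"
    using Inv_translate(2)[OF U] by (simp add: map_prod_surj_on)
  finally show ?thesis unfolding star_norm_def .
qed

lemma diff_eq_lincomb: "A - B = lincomb 1 A (- 1) B"
  by (simp add: lincomb_def fun_eq_iff)

lemma shuffling_isometry:
  assumes U: "U \<in> Inv_copulas" and V: "V \<in> Inv_copulas"
  shows "star_isometry (shuffling U V)"
  unfolding star_isometry_def
proof (intro conjI ballI)
  show "shuffling U V \<in> span_copulas \<rightarrow> span_copulas"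
    using U V by (auto simp: shuffling_def intro!: star_in_span dest: Inv_in_span)
  fix A B assume AB: "A \<in> span_copulas" "B \<in> span_copulas"
  have "shuffling U V A - shuffling U V B = U \<star> (A - B) \<star> V"
    unfolding shuffling_def diff_eq_lincomb using AB U V
    by (simp add: star_lincomb_left star_lincomb_right star_in_span Inv_in_span)
  moreover have "A - B \<in> span_copulas" unfolding diff_eq_lincomb using AB by (rule lincomb_in_span)
  ultimately show "star_norm (shuffling U V A - shuffling U V B) = star_norm (A - B)"
    using U V by (simp add: star_norm_left star_norm_right star_in_span Inv_in_span)
qed

theorem theorem5p2:
  shows "(\<forall>A\<in>span_copulas. \<forall>U\<in>Inv_copulas.
            star_norm (U \<star> A) = star_norm A \<and> star_norm A = star_norm (A \<star> U)) \<and>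
         (\<forall>U\<in>Inv_copulas. \<forall>V\<in>Inv_copulas. star_isometry (shuffling U V))"
  using star_norm_left star_norm_right shuffling_isometry by simp

end
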